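(* Every oriented matroid is path convex.
   Context: Let $\mathcal L\subseteq\{+,-,0\}^E$ be the set of covectors of an oriented matroid of rank $n$ with no loops, ordered as its face lattice ($X\le Y$ iff $X_e\in\{0,Y_e\}$ for all $e$). Regions are the topes (covectors of rank $n$). Two topes are adjacent if there is a covector of rank $n-1$ below both; this defines the adjacency (tope) graph. A polygon is the cycle, in cyclic order, of all topes lying above a fixed covector of rank $n-2$. A path from $Q$ to $R$ is a sequence $R_0=Q,\dots,R_k=R$ of topes with consecutive ones adjacent; its length is $k$; it is reduced if of minimal length among paths from $Q$ to $R$. A braid move replaces a consecutive subsequence $Q_0,\dots,Q_m$ of a path by $Q_0',\dots,Q_m'$ with $Q_0'=Q_0$, $Q_m'=Q_m$ such that $Q_0,\dots,Q_m,Q_{m-1}',\dots,Q_1',Q_0$ is a polygon. A nil move replaces a consecutive subsequence $Q_0,Q_1,Q_2$ with $Q_0=Q_2$ by $Q_0$. The oriented matroid is path convex if for all topes $Q,R$, every path from $Q$ to $R$ can be transformed into any given reduced path from $Q$ to $R$ by a sequence of braid moves and nil moves. *)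

theory Defs
  imports Main
begin

text \<open>A sign vector on \<open>E\<close> is a function into \<open>{-1, 0, 1}\<close>, normalised to be \<open>0\<close> off \<open>E\<close> so that
  equality of functions is equality of sign vectors.\<close>

definition sign_vectors :: "'e set \<Rightarrow> ('e \<Rightarrow> int) set" where
  "sign_vectors E = {X. (\<forall>e\<in>E. X e \<in> {-1, 0, 1}) \<and> (\<forall>e. e \<notin> E \<longrightarrow> X e = 0)}"

definition neg_vec :: "('e \<Rightarrow> int) \<Rightarrow> 'e \<Rightarrow> int" where
  "neg_vec X = (\<lambda>e. - X e)"

definition compose :: "('e \<Rightarrow> int) \<Rightarrow> ('e \<Rightarrow> int) \<Rightarrow> 'e \<Rightarrow> int" where
  "compose X Y = (\<lambda>e. if X e \<noteq> 0 then X e else Y e)"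

definition separation :: "('e \<Rightarrow> int) \<Rightarrow> ('e \<Rightarrow> int) \<Rightarrow> 'e set" where
  "separation X Y = {e. X e \<noteq> 0 \<and> X e = - Y e}"

text \<open>The standard covector axioms.\<close>

locale oriented_matroid =
  fixes E :: "'e set" and L :: "('e \<Rightarrow> int) set"
  assumes finite_ground: "finite E"
    and covectors_sign: "L \<subseteq> sign_vectors E"
    and zero_covector: "(\<lambda>e. 0) \<in> L"
    and neg_covector: "X \<in> L \<Longrightarrow> neg_vec X \<in> L"
    and compose_covector: "X \<in> L \<Longrightarrow> Y \<in> L \<Longrightarrow> compose X Y \<in> L"
    and covector_elimination: "X \<in> L \<Longrightarrow> Y \<in> L \<Longrightarrow> e \<in> separation X Y \<Longrightarrow>
      \<exists>Z\<in>L. Z e = 0 \<and>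
        (\<forall>f\<in>E - separation X Y. Z f = compose X Y f \<and> Z f = compose Y X f)"

definition loopless :: "'e set \<Rightarrow> ('e \<Rightarrow> int) set \<Rightarrow> bool" where
  "loopless E L \<longleftrightarrow> (\<forall>e\<in>E. \<exists>X\<in>L. X e \<noteq> 0)"

text \<open>The face order; it is unrelated to the pointwise order \<open>\<le>\<close> on functions.\<close>

definition face_le :: "('e \<Rightarrow> int) \<Rightarrow> ('e \<Rightarrow> int) \<Rightarrow> bool" (infix \<open>\<preceq>\<close> 50) where
  "X \<preceq> Y \<longleftrightarrow> (\<forall>e. X e \<in> {0, Y e})"

text \<open>Rank of a covector in the face lattice: the maximal length of a chain of covectors ending at
  \<open>X\<close>. The length of a chain is one less than its cardinality, so it is counted here as the number
  of its elements strictly below \<open>X\<close>.\<close>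

definition cov_rank :: "('e \<Rightarrow> int) set \<Rightarrow> ('e \<Rightarrow> int) \<Rightarrow> nat" where
  "cov_rank L X =
     Max {card C | C. C \<subseteq> {Y \<in> L. Y \<preceq> X \<and> Y \<noteq> X} \<and> Complete_Partial_Order.chain (\<preceq>) C}"

definition om_rank :: "('e \<Rightarrow> int) set \<Rightarrow> nat" where
  "om_rank L = Max (cov_rank L ` L)"

definition topes :: "('e \<Rightarrow> int) set \<Rightarrow> ('e \<Rightarrow> int) set" where
  "topes L = {T \<in> L. cov_rank L T = om_rank L}"

text \<open>The tope graph has no graph loops, hence \<open>Q \<noteq> R\<close>. Ranks \<open>n - 1\<close> and \<open>n - 2\<close> are expressed by
  addition because subtraction on \<^typ>\<open>nat\<close> truncates.\<close>

definition adjacent :: "('e \<Rightarrow> int) set \<Rightarrow> ('e \<Rightarrow> int) \<Rightarrow> ('e \<Rightarrow> int) \<Rightarrow> bool" where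
  "adjacent L Q R \<longleftrightarrow> Q \<in> topes L \<and> R \<in> topes L \<and> Q \<noteq> R \<and>
     (\<exists>F\<in>L. cov_rank L F + 1 = om_rank L \<and> F \<preceq> Q \<and> F \<preceq> R)"

text \<open>A polygon is listed without repeating its starting tope; its cyclic order is that of a cycle in
  the tope graph.\<close>

definition polygon :: "('e \<Rightarrow> int) set \<Rightarrow> ('e \<Rightarrow> int) list \<Rightarrow> bool" where
  "polygon L Cs \<longleftrightarrow> 3 \<le> length Cs \<and> distinct Cs \<and>
     (\<exists>F\<in>L. cov_rank L F + 2 = om_rank L \<and> set Cs = {T \<in> topes L. F \<preceq> T}) \<and>
     (\<forall>i<length Cs. adjacent L (Cs ! i) (Cs ! (Suc i mod length Cs)))"

text \<open>A path \<open>R\<^sub>0, \<dots>, R\<^sub>k\<close> is a list with \<open>k + 1\<close> entries.\<close>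

definition path :: "('e \<Rightarrow> int) set \<Rightarrow> ('e \<Rightarrow> int) \<Rightarrow> ('e \<Rightarrow> int) \<Rightarrow> ('e \<Rightarrow> int) list \<Rightarrow> bool" where
  "path L Q R p \<longleftrightarrow> p \<noteq> [] \<and> set p \<subseteq> topes L \<and> hd p = Q \<and> last p = R \<and>
     (\<forall>i. Suc i < length p \<longrightarrow> adjacent L (p ! i) (p ! Suc i))"

definition path_length :: "('e \<Rightarrow> int) list \<Rightarrow> nat" where
  "path_length p = length p - 1"

definition reduced_path ::
  "('e \<Rightarrow> int) set \<Rightarrow> ('e \<Rightarrow> int) \<Rightarrow> ('e \<Rightarrow> int) \<Rightarrow> ('e \<Rightarrow> int) list \<Rightarrow> bool" where
  "reduced_path L Q R p \<longleftrightarrow> path L Q R p \<and> (\<forall>q. path L Q R q \<longrightarrow> path_length p \<le> path_length q)"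

text \<open>In \<open>braid_move\<close> the replaced segment is \<open>Q\<^sub>0 = a\<close>, \<open>Q\<^sub>m = b\<close> with \<open>xs = Q\<^sub>1, \<dots>, Q\<^sub>m\<^sub>-\<^sub>1\<close>, and
  \<open>ys = Q'\<^sub>1, \<dots>, Q'\<^sub>m\<^sub>-\<^sub>1\<close>.\<close>

definition braid_move :: "('e \<Rightarrow> int) set \<Rightarrow> ('e \<Rightarrow> int) list \<Rightarrow> ('e \<Rightarrow> int) list \<Rightarrow> bool" where
  "braid_move L p q \<longleftrightarrow> (\<exists>us a xs ys b vs.
     p = us @ [a] @ xs @ [b] @ vs \<and> q = us @ [a] @ ys @ [b] @ vs \<and>
     length xs = length ys \<and> polygon L ([a] @ xs @ [b] @ rev ys))"

definition nil_move :: "('e \<Rightarrow> int) list \<Rightarrow> ('e \<Rightarrow> int) list \<Rightarrow> bool" where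
  "nil_move p q \<longleftrightarrow> (\<exists>us a b vs. p = us @ [a, b, a] @ vs \<and> q = us @ [a] @ vs)"

definition path_convex :: "('e \<Rightarrow> int) set \<Rightarrow> bool" where
  "path_convex L \<longleftrightarrow> (\<forall>Q\<in>topes L. \<forall>R\<in>topes L. \<forall>p r.
     path L Q R p \<longrightarrow> reduced_path L Q R r \<longrightarrow>
     (\<lambda>s t. braid_move L s t \<or> nil_move s t)\<^sup>*\<^sup>* p r)"

end

theory Submission imports Defs begin

text \<open>The distance of two topes in the tope graph is the number of classes of parallel elements
  separating them, so a path is reduced iff it crosses no class twice. Two reduced paths \<open>p\<close> and \<open>q\<close>
  from \<open>Q\<close> to \<open>R\<close> are connected by braid moves, by induction on the distance and then on the position
  at which \<open>p\<close> crosses the first class \<open>A\<close> of \<open>q\<close>. If \<open>p\<close> crosses \<open>A\<close> at the wall \<open>H\<close> and \<open>q\<close> at the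
  wall \<open>F\<close>, then \<open>F\<close> and \<open>H\<close> are topes of the contraction at \<open>A\<close>; a step from \<open>F\<close> towards \<open>H\<close> there
  gives a corank-two face \<open>G\<close> of \<open>Q\<close> all of whose classes other than \<open>A\<close> are crossed by \<open>p\<close> before \<open>A\<close>.
  Braiding \<open>q\<close> around the polygon of \<open>G\<close> replaces its first class by one that \<open>p\<close> crosses earlier.
  For an arbitrary path \<open>Q, S, \<dots>, R\<close> whose part from \<open>S\<close> on is already reduced, the step from \<open>Q\<close> to
  \<open>S\<close> either decreases the distance to \<open>R\<close>, and the path is reduced, or some reduced path from \<open>S\<close> to
  \<open>R\<close> starts with \<open>S, Q\<close>, and after braiding to it a nil move cancels \<open>Q, S, Q\<close>.\<close>

section \<open>Heights in finite posets\<close>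

text \<open>Instantiated twice, for covectors under the face order and for supports under inclusion.
  Comparing the two heights shows that the rank of a covector depends only on its support.\<close>

locale finite_poset =
  fixes A :: "'a set" and r :: "'a \<Rightarrow> 'a \<Rightarrow> bool"
  assumes finite_carrier: "finite A"
    and r_refl: "r x x"
    and r_antisym: "r x y \<Longrightarrow> r y x \<Longrightarrow> x = y"
    and r_trans: "r x y \<Longrightarrow> r y z \<Longrightarrow> r x z"
begin

text \<open>The formula of \<open>cov_rank\<close> for an arbitrary order, so that the two agree by
  unfolding.\<close>

definition height :: "'a \<Rightarrow> nat" where
  "height x = Max {card C | C. C \<subseteq> {y \<in> A. r y x \<and> y \<noteq> x} \<and> Complete_Partial_Order.chain r C}"

lemma finite_chain_cards:
  "finite {card C | C. C \<subseteq> {y \<in> A. r y x \<and> y \<noteq> x} \<and> Complete_Partial_Order.chain r C}"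
proof -
  have "{card C | C. C \<subseteq> {y \<in> A. r y x \<and> y \<noteq> x} \<and> Complete_Partial_Order.chain r C} \<subseteq> card ` Pow A"
    by auto
  then show ?thesis
    using finite_carrier by (meson finite_Pow_iff finite_imageI finite_subset)
qed

lemma card_chain_le_height:
  "C \<subseteq> {y \<in> A. r y x \<and> y \<noteq> x} \<Longrightarrow> Complete_Partial_Order.chain r C \<Longrightarrow> card C \<le> height x"
  unfolding height_def by (rule Max_ge[OF finite_chain_cards]) blast

lemma ex_longest_chain:
  obtains C where "C \<subseteq> {y \<in> A. r y x \<and> y \<noteq> x}" "Complete_Partial_Order.chain r C" "card C = height x"
proof -
  have "Complete_Partial_Order.chain r {}"
    by (simp add: chain_def)
  then have "{card C | C. C \<subseteq> {y \<in> A. r y x \<and> y \<noteq> x} \<and> Complete_Partial_Order.chain r C} \<noteq> {}"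
    by blast
  from Max_in[OF finite_chain_cards this] show thesis
    using that unfolding height_def by auto
qed

lemma height_less:
  assumes "x \<in> A" "r x y" "x \<noteq> y"
  shows "height x < height y"
proof -
  obtain C where C: "C \<subseteq> {y \<in> A. r y x \<and> y \<noteq> x}" "Complete_Partial_Order.chain r C" "card C = height x"
    by (rule ex_longest_chain)
  have fin: "finite C"
    using C(1) finite_carrier by (auto intro: finite_subset)
  have "insert x C \<subseteq> {z \<in> A. r z y \<and> z \<noteq> y}"
    using C(1) assms r_trans r_antisym by blast
  moreover have "Complete_Partial_Order.chain r (insert x C)"
    using C(1,2) by (auto simp: chain_def intro: r_refl)
  moreover have "card (insert x C) = Suc (card C)"
    using fin C(1) by (subst card_insert_disjoint) auto
  ultimately show ?thesis
    using C card_chain_le_height[of "insert x C" y] by auto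
qed

lemma height_pred:
  assumes "height x = Suc k"
  obtains y where "y \<in> A" "r y x" "y \<noteq> x" "height y = k"
proof -
  obtain C where C: "C \<subseteq> {y \<in> A. r y x \<and> y \<noteq> x}" "Complete_Partial_Order.chain r C" "card C = height x"
    by (rule ex_longest_chain)
  have fin: "finite C"
    using C(1) finite_carrier by (auto intro: finite_subset)
  have "C \<noteq> {}"
    using C(3) assms by auto
  then have "Max (height ` C) \<in> height ` C"
    using fin by (intro Max_in) auto
  then obtain y where y: "y \<in> C" "height y = Max (height ` C)"
    by (metis imageE)
  have le: "height c \<le> height y" if "c \<in> C" for c
    using that fin by (simp add: y(2))
  \<comment> \<open>An element of the chain above \<open>y\<close> would have greater height, so
    \<open>y\<close> is the top of \<open>C\<close>. The rest of the chain then bounds the height of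
    \<open>y\<close> from below.\<close>
  have "r c y" if "c \<in> C" for c
  proof (rule ccontr)
    assume "\<not> r c y"
    then have "r y c" "y \<noteq> c"
      using C(2) that y(1) r_refl by (auto simp: chain_def)
    with height_less[of y c] y(1) C(1) le[OF that] show False
      by auto
  qed
  then have "C - {y} \<subseteq> {z \<in> A. r z y \<and> z \<noteq> y}" "Complete_Partial_Order.chain r (C - {y})"
    using C(1,2) by (auto simp: chain_def)
  then have "card (C - {y}) \<le> height y"
    by (rule card_chain_le_height)
  moreover have "card (C - {y}) = k"
    using fin y(1) C(3) assms by simp
  moreover have "height y < height x"
    using height_less y(1) C(1) by auto
  ultimately show thesis
    using that[of y] y(1) C(1) assms by auto
qed

end

section \<open>Supports, elimination and the rank\<close>

text \<open>For covectors, the complements of these sets in \<open>E\<close> are the flats of the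
  underlying matroid.\<close>

definition supp :: "('e \<Rightarrow> int) \<Rightarrow> 'e set" where
  "supp X = {e. X e \<noteq> 0}"

lemma supp_compose: "supp (compose X Y) = supp X \<union> supp Y"
  by (auto simp: supp_def compose_def)

lemma supp_neg_vec [simp]: "supp (neg_vec X) = supp X"
  by (auto simp: supp_def neg_vec_def)

lemma face_leD: "X \<preceq> Y \<Longrightarrow> X e \<noteq> 0 \<Longrightarrow> Y e = X e"
  unfolding face_le_def by (metis empty_iff insert_iff)

lemma face_leI: "(\<And>e. X e \<noteq> 0 \<Longrightarrow> Y e = X e) \<Longrightarrow> X \<preceq> Y"
  unfolding face_le_def by (metis insert_iff)

lemma face_le_trans: "X \<preceq> Y \<Longrightarrow> Y \<preceq> Z \<Longrightarrow> X \<preceq> Z"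
  by (metis face_leD face_leI)

lemma face_le_antisym: "X \<preceq> Y \<Longrightarrow> Y \<preceq> X \<Longrightarrow> X = Y"
  by (rule ext) (metis face_leD)

lemma face_le_refl [simp]: "X \<preceq> X"
  by (rule face_leI) simp

lemma face_le_supp: "X \<preceq> Y \<Longrightarrow> supp X \<subseteq> supp Y"
  by (auto simp: supp_def dest: face_leD)

lemma face_le_supp_eq: "X \<preceq> Y \<Longrightarrow> supp X = supp Y \<Longrightarrow> X = Y"
  by (rule ext) (metis (mono_tags) face_leD mem_Collect_eq supp_def)

lemma face_le_compose: "X \<preceq> compose X Y"
  by (rule face_leI) (simp add: compose_def)

context oriented_matroid
begin

lemma covector_values: "X \<in> L \<Longrightarrow> X e \<in> {-1, 0, 1}"
  using covectors_sign by (auto simp: sign_vectors_def) 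

lemma covector_off_ground: "X \<in> L \<Longrightarrow> e \<notin> E \<Longrightarrow> X e = 0"
  using covectors_sign by (auto simp: sign_vectors_def)

lemma supp_subset_ground: "X \<in> L \<Longrightarrow> supp X \<subseteq> E"
  using covector_off_ground by (auto simp: supp_def)

lemma finite_supp: "X \<in> L \<Longrightarrow> finite (supp X)"
  using supp_subset_ground finite_ground finite_subset by blast

lemma finite_covectors: "finite L"
proof -
  have "finite {f. \<forall>e. (e \<in> E \<longrightarrow> f e \<in> {-1, 0, 1 :: int}) \<and> (e \<notin> E \<longrightarrow> f e = 0)}"
    using finite_ground by (intro finite_set_of_finite_funs) auto
  then show ?thesis
    using covectors_sign by (elim rev_finite_subset) (auto simp: sign_vectors_def)
qed

sublocale faces: finite_poset L "(\<preceq>)"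
  by unfold_locales (auto intro: finite_covectors face_le_antisym face_le_trans)

sublocale supports: finite_poset "supp ` L" "(\<subseteq>)"
  by unfold_locales (auto intro: finite_covectors)

lemma cov_rank_eq_height: "cov_rank L X = faces.height X"
  by (simp add: cov_rank_def faces.height_def)

section \<open>Elimination and covers of supports\<close>

lemma separation_subset_ground: "X \<in> L \<Longrightarrow> separation X Y \<subseteq> E"
  using covector_off_ground by (auto simp: separation_def)

text \<open>Repeated elimination between \<open>X\<close> and the current covector shrinks the separation set
  until the result conforms to \<open>X\<close>.\<close>

lemma conformal_elimination:
  assumes X: "X \<in> L" and W: "W \<in> L" and sep: "separation X W \<noteq> {}"
  obtains Z e where "Z \<in> L" "e \<in> separation X W" "Z e = 0"
    "\<And>f. f \<in> separation X W \<Longrightarrow> Z f \<in> {0, X f}"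
    "\<And>f. f \<notin> separation X W \<Longrightarrow> Z f = compose X W f"
proof -
  let ?S = "separation X W"
  let ?P = "\<lambda>Z. Z \<in> L \<and> (\<exists>e\<in>?S. Z e = 0) \<and> (\<forall>f. f \<notin> ?S \<longrightarrow> Z f = compose X W f)"
  have step: "\<exists>Z'. ?P Z' \<and> separation X Z' \<subset> separation X Z"
    if Z: "Z \<in> L" "\<forall>f. f \<notin> ?S \<longrightarrow> compose X Z f = compose X W f" "separation X Z \<subseteq> ?S"
      and e: "e \<in> separation X Z" for Z e
  proof -
    obtain Z' where Z': "Z' \<in> L" "Z' e = 0"
      "\<forall>f\<in>E - separation X Z. Z' f = compose X Z f \<and> Z' f = compose Z X f"
      using covector_elimination[OF X Z(1) e] by blast
    have *: "Z' f = compose X Z f" if "f \<notin> separation X Z" for f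
    proof (cases "f \<in> E")
      case False
      then show ?thesis
        using covector_off_ground[OF X] covector_off_ground[OF Z(1)] covector_off_ground[OF Z'(1)]
        by (simp add: compose_def)
    qed (use Z'(3) that in auto)
    have "f \<in> separation X Z" if "f \<in> separation X Z'" for f
      using *[of f] that by (auto simp: separation_def compose_def split: if_splits)
    moreover have "e \<notin> separation X Z'"
      using Z'(2) by (auto simp: separation_def)
    ultimately have "separation X Z' \<subset> separation X Z"
      using e by blast
    moreover have "?P Z'"
      using Z' Z e * by (metis subsetD)
    ultimately show ?thesis
      by blast
  qed
  obtain e where "e \<in> ?S"
    using sep by blast
  then obtain Z0 where Z0: "?P Z0"
    using step[of W e] W by auto
  \<comment> \<open>A choice with the smallest separation set from \<open>X\<close>. As
    \<open>step\<close> would shrink a nonempty one further, it is empty, which leaves only the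
    values \<open>0\<close> and \<open>X f\<close>.\<close>
  obtain Z where Z: "?P Z" "\<And>Z'. ?P Z' \<Longrightarrow> card (separation X Z) \<le> card (separation X Z')"
    using ex_has_least_nat[of ?P Z0 "\<lambda>Z. card (separation X Z)", OF Z0] by blast
  have off: "compose X Z f = compose X W f" if "f \<notin> ?S" for f
    using Z(1) that by (auto simp: compose_def)
  have sub: "separation X Z \<subseteq> ?S"
  proof
    fix f assume f: "f \<in> separation X Z"
    show "f \<in> ?S"
    proof (rule ccontr)
      assume "f \<notin> ?S"
      then have "Z f = compose X W f"
        using Z(1) by blast
      with f show False
        by (auto simp: separation_def compose_def split: if_splits)
    qed
  qed
  have fin: "finite (separation X Z)"
    using separation_subset_ground[OF X] finite_ground finite_subset by blast
  have empty: "separation X Z = {}"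
  proof (rule ccontr)
    assume "separation X Z \<noteq> {}"
    then obtain e where "e \<in> separation X Z"
      by blast
    then obtain Z' where Z': "?P Z'" "separation X Z' \<subset> separation X Z"
      using step[of Z e] Z(1) off sub by blast
    show False
      using Z(2)[OF Z'(1)] psubset_card_mono[OF fin Z'(2)] by linarith
  qed
  have "Z f \<in> {0, X f}" if "f \<in> ?S" for f
  proof -
    have "X f \<noteq> 0" "Z f \<noteq> - X f"
      using that empty by (auto simp: separation_def)
    then show ?thesis
      using covector_values[OF X, of f] covector_values[of Z f] Z(1) by auto
  qed
  then show thesis
    using that Z(1) by blast
qed

text \<open>The covector \<open>X'\<close> composed with \<open>Y\<close> has the support of
  \<open>Y\<close> and lies above \<open>X'\<close>. If it conforms to \<open>X\<close>, it is the
  face sought. Otherwise conformal elimination of \<open>X\<close> against it gives a proper face of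
  \<open>X\<close> that agrees with \<open>X\<close> on \<open>X'\<close> and also outside
  \<open>supp Y\<close>, hence differs from \<open>X'\<close>.\<close>

lemma face_strictly_between:
  assumes "X \<in> L" "Y \<in> L" "X' \<in> L" "X' \<preceq> X" "supp X' \<subset> supp Y" "supp Y \<subset> supp X"
  obtains W where "W \<in> L" "X' \<preceq> W" "W \<preceq> X" "W \<noteq> X'" "W \<noteq> X"
proof -
  define V where "V = compose X' Y"
  have V: "V \<in> L" "supp V = supp Y" "X' \<preceq> V" "\<And>f. f \<in> supp X' \<Longrightarrow> V f = X f"
    using assms face_leD[OF assms(4)]
    by (auto simp: V_def compose_covector supp_compose face_le_compose) (auto simp: compose_def supp_def)
  show thesis
  proof (cases "separation X V = {}")
    case True
    have "X f = V f" if "V f \<noteq> 0" for f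
    proof -
      have "X f \<noteq> 0" "X f \<noteq> - V f"
        using V(2) assms(6) that True by (auto simp: separation_def supp_def)
      then show ?thesis
        using covector_values[OF V(1), of f] covector_values[OF assms(1), of f] that by auto
    qed
    then have "V \<preceq> X"
      by (rule face_leI)
    then show ?thesis
      using that[of V] V assms by auto
  next
    case False
    then obtain Z e where Z: "Z \<in> L" "e \<in> separation X V" "Z e = 0"
      "\<And>f. f \<in> separation X V \<Longrightarrow> Z f \<in> {0, X f}"
      "\<And>f. f \<notin> separation X V \<Longrightarrow> Z f = compose X V f"
      using conformal_elimination[OF assms(1) V(1)] by metis
    have ZX: "Z f = X f" if "f \<notin> separation X V" for f
    proof -
      have "X f = 0 \<Longrightarrow> V f = 0"
        using V(2) assms(6) by (auto simp: supp_def)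
      then show ?thesis
        using Z(5)[OF that] by (auto simp: compose_def)
    qed
    have "Z \<preceq> X"
      by (rule face_leI) (metis Z(4) ZX empty_iff insert_iff)
    moreover have "Z \<noteq> X"
      using Z(2,3) by (auto simp: separation_def)
    moreover have "X' \<preceq> Z"
    proof (rule face_leI)
      fix f assume "X' f \<noteq> 0"
      then have "f \<notin> separation X V"
        using V(4)[of f] face_leD[OF assms(4), of f] by (auto simp: supp_def separation_def)
      then show "Z f = X' f"
        using ZX face_leD[OF assms(4) \<open>X' f \<noteq> 0\<close>] by simp
    qed
    moreover have "Z \<noteq> X'"
    proof -
      obtain g where g: "g \<in> supp X" "g \<notin> supp Y"
        using assms(6) by blast
      then have "g \<notin> supp V"
        using V(2) by simp
      with g(1) have "g \<notin> separation X V"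
        by (simp add: supp_def separation_def)
      then have "g \<in> supp Z" "g \<notin> supp X'"
        using ZX g assms(5) by (auto simp: supp_def)
      then show ?thesis
        by blast
    qed
    ultimately show ?thesis
      using that Z(1) by blast
  qed
qed

text \<open>Lower semimodularity of the lattice of supports: if \<open>A \<union> B\<close> covers \<open>A\<close>, then \<open>B\<close> covers the
  largest support \<open>D\<close> inside \<open>A \<inter> B\<close>.\<close>

lemma height_support_le:
  assumes "S \<in> supp ` L" "A \<in> supp ` L" "A \<subset> S" "\<And>C. C \<in> supp ` L \<Longrightarrow> A \<subset> C \<Longrightarrow> C \<subset> S \<Longrightarrow> False"
  shows "supports.height S \<le> Suc (supports.height A)"
  using assms
proof (induction "card S" arbitrary: S A rule: less_induct)
  case (less S A)
  have finS: "finite S"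
    using less.prems(1) finite_supp by auto
  show ?case
  proof (cases "supports.height S")
    case (Suc k)
    then obtain B where B: "B \<in> supp ` L" "B \<subset> S" "supports.height B = k"
      using supports.height_pred[OF Suc] by blast
    have B_cov: False if "C \<in> supp ` L" "B \<subset> C" "C \<subset> S" for C
    proof -
      have "supports.height B < supports.height C" "supports.height C < supports.height S"
        using that B(1) by (auto intro!: supports.height_less)
      then show False
        using B(3) Suc by simp
    qed
    show ?thesis
    proof (cases "A = B")
      case False
      have un: "C \<union> D \<in> supp ` L" if "C \<in> supp ` L" "D \<in> supp ` L" for C D
        using that compose_covector supp_compose by (metis (no_types, lifting) imageE imageI)
      have "\<not> B \<subseteq> A" "\<not> A \<subseteq> B"
        using False less.prems B B_cov by blast+
      have A_un: "A \<union> C = S" if C: "C \<in> supp ` L" "C \<subseteq> S" "\<not> C \<subseteq> A" for C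
      proof (rule ccontr)
        assume "A \<union> C \<noteq> S"
        moreover have "A \<union> C \<subseteq> S" "A \<subset> A \<union> C"
          using less.prems(3) C(2,3) by auto
        ultimately show False
          using less.prems(4)[OF un[OF less.prems(2) C(1)]] by auto
      qed
      \<comment> \<open>Supports are closed under union, so a maximal support inside
        \<open>A\<close> and \<open>B\<close> is the largest one.\<close>
      let ?P = "\<lambda>D. D \<in> supp ` L \<and> D \<subseteq> A \<inter> B"
      have "?P (supp (\<lambda>e. 0))"
        using zero_covector by (auto simp: supp_def)
      moreover have "finite {D. ?P D}"
        using finite_covectors by auto
      ultimately have "\<exists>D\<in>{D. ?P D}. \<forall>D'\<in>{D. ?P D}. D \<subseteq> D' \<longrightarrow> D = D'"
        by (intro finite_has_maximal) blast+
      then obtain D where "D \<in> {D. ?P D}" "\<forall>D'\<in>{D. ?P D}. D \<subseteq> D' \<longrightarrow> D = D'"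
        by (rule bexE)
      then have D: "?P D" "\<And>D'. ?P D' \<Longrightarrow> D \<subseteq> D' \<Longrightarrow> D = D'"
        by simp_all
      have D_max: "D' \<subseteq> D" if "?P D'" for D'
      proof -
        have "?P (D \<union> D')"
          using un[of D D'] that D(1) by simp
        then have "D = D \<union> D'"
          by (rule D(2)) simp
        then show ?thesis
          by blast
      qed
      \<comment> \<open>Eliminating an element \<open>f\<close> of \<open>C - A\<close> between
        covectors with supports \<open>C\<close> and \<open>B\<close> gives a support inside
        \<open>B\<close> that misses \<open>f\<close>. By \<open>A_un\<close> it lies in
        \<open>A\<close>, hence in \<open>D\<close>; yet it contains every element of
        \<open>B - C\<close>.\<close>
      have cov: False if C: "C \<in> supp ` L" "D \<subset> C" "C \<subset> B" for C
      proof -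
        have "\<not> C \<subseteq> A"
          using D_max[of C] C by blast
        then have AC: "A \<union> C = S"
          using A_un[OF C(1)] B(2) C(3) by auto
        obtain f where f: "f \<in> C" "f \<notin> A"
          using \<open>\<not> C \<subseteq> A\<close> by blast
        obtain c b0 where c: "c \<in> L" "C = supp c" and b0: "b0 \<in> L" "B = supp b0"
          using C(1) B(1) by blast
        \<comment> \<open>Elimination at \<open>f\<close> requires opposite signs there, which
          negating \<open>b0\<close> achieves if necessary.\<close>
        have "\<exists>b\<in>L. B = supp b \<and> f \<in> separation c b"
        proof (cases "f \<in> separation c b0")
          case False
          then have "f \<in> separation c (neg_vec b0)"
            using f C(3) c b0 covector_values[OF c(1), of f] covector_values[OF b0(1), of f]
            by (auto simp: separation_def supp_def neg_vec_def)
          then show ?thesis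
            using b0 neg_covector[OF b0(1)] by (intro bexI[of _ "neg_vec b0"]) auto
        qed (use b0 in auto)
        then obtain b where b: "b \<in> L" "B = supp b" "f \<in> separation c b"
          by blast
        obtain Z where Z: "Z \<in> L" "Z f = 0"
          "\<forall>g\<in>E - separation c b. Z g = compose c b g \<and> Z g = compose b c g"
          using covector_elimination[OF c(1) b(1,3)] by blast
        have ZB: "supp Z \<subseteq> B"
        proof
          fix g assume g: "g \<in> supp Z"
          show "g \<in> B"
          proof (cases "g \<in> separation c b")
            case True
            then show ?thesis
              using b(2) by (auto simp: supp_def separation_def)
          next
            case False
            then have "Z g = compose c b g"
              using Z(3) g supp_subset_ground[OF Z(1)] by blast
            then show ?thesis
              using g c b C(3) by (auto simp: supp_def compose_def split: if_splits)
          qed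
        qed
        have "f \<notin> supp Z" "f \<in> S"
          using Z(2) f AC by (auto simp: supp_def)
        then have "supp Z \<subseteq> A"
          using A_un[OF imageI[OF Z(1)]] ZB B(2) f(2) by auto
        then have ZD: "supp Z \<subseteq> D"
          using D_max[of "supp Z"] ZB Z(1) by blast
        obtain g where g: "g \<in> B" "g \<notin> C"
          using C(3) by blast
        then have "g \<notin> separation c b" "g \<in> E"
          using c b supp_subset_ground[OF b(1)] by (auto simp: supp_def separation_def)
        then have "Z g = compose c b g"
          using Z(3) by blast
        then have "g \<in> supp Z"
          using g c b by (auto simp: supp_def compose_def)
        then show False
          using ZD C(2) g by blast
      qed
      have "D \<subset> B" "D \<subset> A"
        using D(1) \<open>\<not> B \<subseteq> A\<close> \<open>\<not> A \<subseteq> B\<close> by blast+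
      \<comment> \<open>The induction hypothesis for the cover of \<open>D\<close> by
        \<open>B\<close>, written with h for the height: h(S) = h(B) + 1 <= h(D) + 2 <= h(A) + 1,
        the last because \<open>D\<close> is strictly inside \<open>A\<close>.\<close>
      have "card B < card S"
        using B(2) finS by (rule psubset_card_mono[rotated])
      then have "supports.height B \<le> Suc (supports.height D)"
        using less.hyps[of B D] cov \<open>D \<subset> B\<close> B(1) D(1) by blast
      moreover have "supports.height D < supports.height A"
        using supports.height_less[of D A] D(1) \<open>D \<subset> A\<close> by blast
      ultimately show ?thesis
        using Suc B(3) by simp
    qed (use Suc B in simp)
  qed simp
qed

section \<open>The rank of a covector as the height of its support\<close>

lemma ex_maximal_face:
  assumes "W \<in> L" "X \<in> L" "W \<preceq> X" "W \<noteq> X"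
  obtains F where "F \<in> L" "W \<preceq> F" "F \<preceq> X" "F \<noteq> X"
    "\<And>C. C \<in> L \<Longrightarrow> F \<preceq> C \<Longrightarrow> C \<preceq> X \<Longrightarrow> C = F \<or> C = X"
proof -
  let ?P = "\<lambda>F. F \<in> L \<and> W \<preceq> F \<and> F \<preceq> X \<and> F \<noteq> X"
  have fin: "finite {F. ?P F}"
    using finite_covectors by auto
  have "{F. ?P F} \<noteq> {}"
    using assms by auto
  then have "Max (faces.height ` {F. ?P F}) \<in> faces.height ` {F. ?P F}"
    using fin by (intro Max_in) auto
  then obtain F where F: "?P F" "faces.height F = Max (faces.height ` {F. ?P F})"
    by (elim imageE) simp
  have "C = F \<or> C = X" if "C \<in> L" "F \<preceq> C" "C \<preceq> X" for C
  proof (rule ccontr)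
    assume C: "\<not> (C = F \<or> C = X)"
    then have "C \<in> {F. ?P F}"
      using that F(1) face_le_trans by blast
    then have "faces.height C \<le> faces.height F"
      using fin by (simp add: F(2))
    then show False
      using faces.height_less[of F C] F(1) that C by auto
  qed
  then show thesis
    using that F(1) by blast
qed

text \<open>By \<open>face_strictly_between\<close>, a cover in the face order is also a cover of
  supports, to which \<open>height_support_le\<close> applies.\<close>

lemma height_support_cover:
  assumes "F \<in> L" "X \<in> L" "F \<preceq> X" "F \<noteq> X" "\<And>C. C \<in> L \<Longrightarrow> F \<preceq> C \<Longrightarrow> C \<preceq> X \<Longrightarrow> C = F \<or> C = X"
  shows "supports.height (supp X) = Suc (supports.height (supp F))"
proof -
  have "supp F \<subset> supp X"
    using face_le_supp[OF assms(3)] face_le_supp_eq[OF assms(3)] assms(4) by blast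
  moreover have False if C: "C \<in> supp ` L" "supp F \<subset> C" "C \<subset> supp X" for C
  proof -
    obtain Y where "Y \<in> L" "C = supp Y"
      using C(1) by blast
    then show False
      using face_strictly_between[OF assms(2) _ assms(1,3)] assms(5) C by metis
  qed
  ultimately have "supports.height (supp X) \<le> Suc (supports.height (supp F))"
    using height_support_le assms(1,2) by blast
  moreover have "supports.height (supp F) < supports.height (supp X)"
    using supports.height_less[of "supp F" "supp X"] \<open>supp F \<subset> supp X\<close> assms(1) by blast
  ultimately show ?thesis
    by simp
qed

text \<open>Two proper faces of \<open>X\<close> are compared: \<open>Y\<close>, one below
  \<open>X\<close> in face height, and a maximal one \<open>F\<close>, one below \<open>X\<close> in
  support height. By induction the two heights agree on \<open>Y\<close> and on \<open>F\<close>,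
  which forces them to agree on \<open>X\<close>.\<close>

lemma cov_rank_eq_height_supp:
  assumes "X \<in> L"
  shows "cov_rank L X = supports.height (supp X)"
  unfolding cov_rank_eq_height
  using assms
proof (induction "faces.height X" arbitrary: X rule: less_induct)
  case (less X)
  show ?case
  proof (cases "X = (\<lambda>e. 0)")
    case False
    have "(\<lambda>e. 0) \<preceq> X"
      by (simp add: face_le_def)
    with False obtain F where F: "F \<in> L" "F \<preceq> X" "F \<noteq> X"
      "\<And>C. C \<in> L \<Longrightarrow> F \<preceq> C \<Longrightarrow> C \<preceq> X \<Longrightarrow> C = F \<or> C = X"
      using ex_maximal_face[OF zero_covector less.prems] by metis
    have lt: "faces.height F < faces.height X"
      using faces.height_less F by blast
    then obtain k where k: "faces.height X = Suc k"
      by (cases "faces.height X") auto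
    then obtain Y where Y: "Y \<in> L" "Y \<preceq> X" "Y \<noteq> X" "faces.height Y = k"
      by (rule faces.height_pred)
    have "supp Y \<subset> supp X"
      using face_le_supp[OF Y(2)] face_le_supp_eq[OF Y(2)] Y(3) by blast
    then have "supports.height (supp Y) < supports.height (supp X)"
      using supports.height_less[of "supp Y" "supp X"] Y(1) by blast
    moreover have "supports.height (supp X) = Suc (supports.height (supp F))"
      using height_support_cover[OF F(1) less.prems F(2-4)] .
    moreover have "faces.height Y = supports.height (supp Y)" "faces.height F = supports.height (supp F)"
      using less.hyps Y F lt k by auto
    ultimately show ?thesis
      using lt k Y(4) by simp
  next
    case True
    have "faces.height X = 0"
    proof (cases "faces.height X")
      case (Suc k)
      then obtain Y where "Y \<in> L" "Y \<preceq> X" "Y \<noteq> X"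
        by (rule faces.height_pred)
      then have False
        using True face_leD by fastforce
      then show ?thesis ..
    qed
    moreover have "supports.height (supp X) = 0"
    proof (cases "supports.height (supp X)")
      case (Suc k)
      then obtain Y where "Y \<subseteq> supp X" "Y \<noteq> supp X"
        by (rule supports.height_pred)
      then have False
        using True by (auto simp: supp_def)
      then show ?thesis ..
    qed
    ultimately show ?thesis
      by simp
  qed
qed

lemma cov_rank_supp_less:
  "X \<in> L \<Longrightarrow> Y \<in> L \<Longrightarrow> supp X \<subset> supp Y \<Longrightarrow> cov_rank L X < cov_rank L Y"
  using supports.height_less[of "supp X" "supp Y"] by (auto simp: cov_rank_eq_height_supp)

lemma cov_rank_less:
  "X \<in> L \<Longrightarrow> Y \<in> L \<Longrightarrow> X \<preceq> Y \<Longrightarrow> X \<noteq> Y \<Longrightarrow> cov_rank L X < cov_rank L Y"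
  using faces.height_less by (auto simp: cov_rank_eq_height)

lemma cov_rank_supp_eq:
  "X \<in> L \<Longrightarrow> Y \<in> L \<Longrightarrow> supp X = supp Y \<Longrightarrow> cov_rank L X = cov_rank L Y"
  by (simp add: cov_rank_eq_height_supp)

lemma ex_facet_above:
  assumes "W \<in> L" "X \<in> L" "W \<preceq> X" "W \<noteq> X"
  obtains F where "F \<in> L" "W \<preceq> F" "F \<preceq> X" "F \<noteq> X" "cov_rank L F + 1 = cov_rank L X"
proof -
  obtain F where F: "F \<in> L" "W \<preceq> F" "F \<preceq> X" "F \<noteq> X"
    "\<And>C. C \<in> L \<Longrightarrow> F \<preceq> C \<Longrightarrow> C \<preceq> X \<Longrightarrow> C = F \<or> C = X"
    using ex_maximal_face[OF assms] by metis
  then have "cov_rank L X = Suc (cov_rank L F)"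
    using height_support_cover[OF F(1) assms(2)] assms(2) by (simp add: cov_rank_eq_height_supp)
  then show thesis
    using that F by simp
qed

end

section \<open>Topes and walls\<close>

locale loopless_oriented_matroid = oriented_matroid +
  assumes loopless: "loopless E L"
begin

text \<open>Composing covectors that are nonzero at the individual elements fills all of
  \<open>E\<close>. This identifies the topes with the covectors of full support.\<close>

lemma ex_full_support: "\<exists>X\<in>L. supp X = E"
proof -
  have "\<exists>X\<in>L. B \<subseteq> supp X" if "finite B" "B \<subseteq> E" for B
    using that
  proof (induction B rule: finite_induct)
    case empty
    then show ?case
      using zero_covector by auto
  next
    case (insert e B)
    then obtain X Y where "X \<in> L" "B \<subseteq> supp X" "Y \<in> L" "Y e \<noteq> 0"
      using loopless unfolding loopless_def by blast
    then show ?case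
      by (intro bexI[of _ "compose X Y"]) (auto simp: supp_compose compose_covector, auto simp: supp_def)
  qed
  from this[OF finite_ground] show ?thesis
    using supp_subset_ground by blast
qed

lemma om_rank_eq: "T \<in> L \<Longrightarrow> supp T = E \<Longrightarrow> om_rank L = cov_rank L T"
  unfolding om_rank_def
proof (rule Max_eqI)
  fix y assume T: "T \<in> L" "supp T = E" and "y \<in> cov_rank L ` L"
  then obtain X where "X \<in> L" "y = cov_rank L X"
    by blast
  then show "y \<le> cov_rank L T"
    using T cov_rank_supp_less[of X T] cov_rank_supp_eq[of X T] supp_subset_ground[of X] by fastforce
qed (use finite_covectors in auto)

lemma topes_iff: "T \<in> topes L \<longleftrightarrow> T \<in> L \<and> supp T = E"
proof
  assume T: "T \<in> topes L"
  obtain S where S: "S \<in> L" "supp S = E"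
    using ex_full_support by blast
  have "\<not> supp T \<subset> supp S"
    using T S cov_rank_supp_less[of T S] om_rank_eq[OF S] by (auto simp: topes_def)
  then show "T \<in> L \<and> supp T = E"
    using T S supp_subset_ground[of T] by (auto simp: topes_def)
qed (auto simp: topes_def om_rank_eq)

lemma tope_covector: "T \<in> topes L \<Longrightarrow> T \<in> L"
  by (simp add: topes_iff)

lemma tope_supp: "T \<in> topes L \<Longrightarrow> supp T = E"
  by (simp add: topes_iff)

lemma tope_rank: "T \<in> topes L \<Longrightarrow> cov_rank L T = om_rank L"
  by (simp add: topes_def)

lemma compose_tope: "X \<in> L \<Longrightarrow> T \<in> topes L \<Longrightarrow> compose X T \<in> topes L"
  using supp_subset_ground by (auto simp: topes_iff compose_covector supp_compose)

lemma neg_tope: "T \<in> topes L \<Longrightarrow> neg_vec T \<in> topes L"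
  by (auto simp: topes_iff neg_covector)

lemma separation_eq_disagreement:
  assumes "X \<in> L" "W \<in> L" "supp X = supp W"
  shows "separation X W = {e. X e \<noteq> W e}"
proof -
  have "e \<in> separation X W \<longleftrightarrow> X e \<noteq> W e" for e
  proof -
    have "X e \<noteq> 0 \<longleftrightarrow> W e \<noteq> 0"
      using assms(3) unfolding supp_def by blast
    then show ?thesis
      using covector_values[OF assms(1), of e] covector_values[OF assms(2), of e]
      by (auto simp: separation_def)
  qed
  then show ?thesis
    by blast
qed

lemma tope_separation: "Q \<in> topes L \<Longrightarrow> R \<in> topes L \<Longrightarrow> separation Q R = {e. Q e \<noteq> R e}"
  by (simp add: topes_iff separation_eq_disagreement)

text \<open>Conformal elimination against \<open>W\<close> yields a proper face of \<open>X\<close>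
  that loses only elements where \<open>X\<close> and \<open>W\<close> differ; a facet of
  \<open>X\<close> above that face loses no others. It is the source of every step towards a goal,
  both among topes and among walls.\<close>

lemma facet_in_disagreement:
  assumes X: "X \<in> L" and W: "W \<in> L" and eq: "supp X = supp W" and ne: "X \<noteq> W"
  obtains F where "F \<in> L" "F \<preceq> X" "F \<noteq> X" "cov_rank L F + 1 = cov_rank L X"
    "supp X - supp F \<subseteq> separation X W"
proof -
  have "separation X W \<noteq> {}"
    using ne by (auto simp: separation_eq_disagreement[OF X W eq] fun_eq_iff)
  then obtain Z e where Z: "Z \<in> L" "e \<in> separation X W" "Z e = 0"
    "\<And>f. f \<in> separation X W \<Longrightarrow> Z f \<in> {0, X f}"
    "\<And>f. f \<notin> separation X W \<Longrightarrow> Z f = compose X W f"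
    using conformal_elimination[OF X W] by metis
  have ZX: "Z f = X f" if "f \<notin> separation X W" for f
    using Z(5)[OF that] that by (auto simp: compose_def separation_eq_disagreement[OF X W eq])
  have "Z \<preceq> X"
    by (rule face_leI) (metis Z(4) ZX empty_iff insert_iff)
  moreover have "Z \<noteq> X"
    using Z(2,3) by (auto simp: separation_def)
  ultimately obtain F where F: "F \<in> L" "Z \<preceq> F" "F \<preceq> X" "F \<noteq> X" "cov_rank L F + 1 = cov_rank L X"
    using ex_facet_above[OF Z(1) X] by metis
  have "supp X - supp F \<subseteq> separation X W"
  proof
    fix f assume f: "f \<in> supp X - supp F"
    then have "Z f \<noteq> X f"
      using face_le_supp[OF F(2)] unfolding supp_def by force
    then show "f \<in> separation X W"
      using ZX by blast
  qed
  then show thesis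
    using that F by blast
qed

lemma no_covector_between:
  assumes "X \<in> L" "Y \<in> L" "Z \<in> L" "X \<preceq> Y" "Y \<preceq> Z" "cov_rank L X + 1 = cov_rank L Z"
  shows "Y = X \<or> Y = Z"
  using cov_rank_less[of X Y] cov_rank_less[of Y Z] assms by force

lemma face_le_restrict: "G \<preceq> Q \<Longrightarrow> F \<preceq> Q \<Longrightarrow> supp G \<subseteq> supp F \<Longrightarrow> G \<preceq> F"
  by (rule face_leI) (metis (mono_tags, lifting) face_leD mem_Collect_eq subsetD supp_def)

text \<open>The facet \<open>F\<close> from \<open>facet_in_disagreement\<close> loses only elements
  where \<open>X\<close> and \<open>W\<close> differ, and they agree on \<open>G\<close>. So
  \<open>F\<close> lies above \<open>G\<close>, and the ranks force \<open>F = G\<close>.\<close>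

lemma separation_over_facet:
  assumes "G \<in> L" "X \<in> L" "W \<in> L" "supp X = supp W" "G \<preceq> X" "G \<preceq> W"
    and "cov_rank L G + 1 = cov_rank L X" "X \<noteq> W"
  shows "separation X W = supp X - supp G"
proof -
  obtain F where F: "F \<in> L" "F \<preceq> X" "F \<noteq> X" "supp X - supp F \<subseteq> separation X W"
    using facet_in_disagreement assms(2,3,4,8) by metis
  have sub: "separation X W \<subseteq> supp X - supp G"
    using face_leD[OF assms(5)] face_leD[OF assms(6)]
    by (fastforce simp: separation_def supp_def)
  then have "supp G \<subseteq> supp F"
    using F(4) face_le_supp[OF assms(5)] by blast
  then have "F = G"
    using no_covector_between[of G F X] face_le_restrict[OF assms(5) F(2)] assms F by blast
  then show ?thesis
    using sub F(4) by blast
qed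

lemma ex_adjacent_towards:
  assumes Q: "Q \<in> topes L" and R: "R \<in> topes L" and "Q \<noteq> R"
  obtains Q' where "adjacent L Q Q'" "separation Q Q' \<subseteq> separation Q R"
proof -
  obtain F where F: "F \<in> L" "F \<preceq> Q" "F \<noteq> Q" "cov_rank L F + 1 = cov_rank L Q"
    "supp Q - supp F \<subseteq> separation Q R"
    using facet_in_disagreement assms tope_covector tope_supp by metis
  \<comment> \<open>The signs lost in passing to the wall \<open>F\<close> are refilled from
    \<open>R\<close>, so every change brings the tope closer to \<open>R\<close>.\<close>
  let ?Q' = "compose F R"
  have Q': "?Q' \<in> topes L"
    using compose_tope F(1) R by blast
  obtain e where e: "e \<in> supp Q" "e \<notin> supp F"
    using F(2,3) face_le_supp[OF F(2)] face_le_supp_eq[OF F(2)] by blast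
  then have "Q e \<noteq> ?Q' e"
    using F(5) tope_separation[OF Q R] by (auto simp: compose_def supp_def)
  then have "Q \<noteq> ?Q'"
    by metis
  then have adj: "adjacent L Q ?Q'"
    unfolding adjacent_def using Q Q' F tope_rank[OF Q] face_le_compose by metis
  have "separation Q ?Q' \<subseteq> separation Q R"
  proof
    fix f assume f: "f \<in> separation Q ?Q'"
    then have "F f = 0"
      using face_leD[OF F(2), of f] by (auto simp: separation_def compose_def)
    moreover have "Q f \<noteq> 0"
      using f by (simp add: separation_def)
    ultimately show "f \<in> separation Q R"
      using F(5) by (auto simp: supp_def)
  qed
  with adj show thesis
    using that by blast
qed

section \<open>Adjacency and classes of parallel elements\<close>

lemma adjacent_topes: "adjacent L Q R \<Longrightarrow> Q \<in> topes L \<and> R \<in> topes L \<and> Q \<noteq> R"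
  by (simp add: adjacent_def)

lemma adjacent_sym: "adjacent L Q R \<Longrightarrow> adjacent L R Q"
  by (auto simp: adjacent_def)

lemma adjacent_wall:
  assumes "adjacent L Q R"
  obtains F where "F \<in> L" "cov_rank L F + 1 = om_rank L" "F \<preceq> Q" "F \<preceq> R"
    "separation Q R = E - supp F"
proof -
  obtain F where F: "F \<in> L" "cov_rank L F + 1 = om_rank L" "F \<preceq> Q" "F \<preceq> R"
    and QR: "Q \<in> topes L" "R \<in> topes L" "Q \<noteq> R"
    using assms by (auto simp: adjacent_def)
  then have "separation Q R = E - supp F"
    using separation_over_facet[of F Q R] by (simp add: topes_iff om_rank_eq)
  with F show thesis
    using that by blast
qed

text \<open>Three different topes above one wall would be pairwise opposite at an element outside
  its support, which is impossible for nonzero signs.\<close>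

lemma wall_unique:
  assumes "adjacent L Q R" "T \<in> topes L" "F \<in> L" "cov_rank L F + 1 = om_rank L"
    "F \<preceq> Q" "F \<preceq> R" "F \<preceq> T"
  shows "T = Q \<or> T = R"
proof (rule ccontr)
  assume ne: "\<not> (T = Q \<or> T = R)"
  have QR: "Q \<in> topes L" "R \<in> topes L" "Q \<noteq> R"
    using assms(1) adjacent_topes by auto
  have *: "separation X Y = E - supp F" if "X \<in> topes L" "Y \<in> topes L" "F \<preceq> X" "F \<preceq> Y" "X \<noteq> Y" for X Y
    using separation_over_facet[of F X Y] that assms(3,4) by (simp add: topes_iff om_rank_eq)
  have eqs: "separation Q R = E - supp F" "separation Q T = E - supp F" "separation R T = E - supp F"
    using * QR assms ne by blast+
  obtain e where "Q e \<noteq> R e"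
    using QR(3) by blast
  then have "e \<in> separation Q R"
    using tope_separation QR by simp
  then have "e \<in> separation Q R" "e \<in> separation Q T" "e \<in> separation R T"
    using eqs by blast+
  then have "Q e \<noteq> 0" "Q e = - R e" "Q e = - T e" "R e = - T e"
    unfolding separation_def by blast+
  then show False
    by simp
qed

text \<open>The wall composed with any tope \<open>X\<close> is \<open>Q\<close> or \<open>R\<close>
  by \<open>wall_unique\<close>. Hence on the elements between \<open>Q\<close> and \<open>R\<close>
  the tope \<open>X\<close> agrees entirely with one of the two.\<close>

lemma separation_classes_cases:
  assumes "adjacent L Q R" "S \<in> topes L" "T \<in> topes L"
  shows "separation Q R \<subseteq> separation S T \<or> separation Q R \<inter> separation S T = {}"
proof -
  obtain F where F: "F \<in> L" "cov_rank L F + 1 = om_rank L" "F \<preceq> Q" "F \<preceq> R"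
    "separation Q R = E - supp F"
    using adjacent_wall[OF assms(1)] by metis
  have QR: "Q \<in> topes L" "R \<in> topes L"
    using assms(1) adjacent_topes by auto
  have *: "(\<forall>e\<in>separation Q R. X e = Q e) \<or> (\<forall>e\<in>separation Q R. X e = R e)" if "X \<in> topes L" for X
  proof -
    have "compose F X = Q \<or> compose F X = R"
      using wall_unique[OF assms(1) _ F(1-4)] compose_tope[OF F(1) that] face_le_compose by blast
    moreover have "compose F X e = X e" if "e \<in> separation Q R" for e
      using that F(5) by (simp add: compose_def supp_def)
    ultimately show ?thesis
      by metis
  qed
  show ?thesis
  proof -
    have "Q e \<noteq> R e" if "e \<in> separation Q R" for e
      using that tope_separation[OF QR] by blast
    then have "(\<forall>e\<in>separation Q R. S e = T e) \<or> (\<forall>e\<in>separation Q R. S e \<noteq> T e)"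
      using *[OF assms(2)] *[OF assms(3)] by metis
    then show ?thesis
      unfolding tope_separation[OF assms(2,3)] by blast
  qed
qed

text \<open>Otherwise \<open>Z\<close> composed with \<open>Q\<close> and with
  \<open>neg_vec Q\<close> would give two topes separated at \<open>e\<close> but not at
  \<open>f\<close>.\<close>

lemma covector_zero_on_class:
  assumes "adjacent L Q R" "Z \<in> L" "e \<in> separation Q R" "f \<in> separation Q R" "Z e = 0"
  shows "Z f = 0"
proof (rule ccontr)
  assume "Z f \<noteq> 0"
  have Q: "Q \<in> topes L"
    using assms(1) adjacent_topes by auto
  let ?S = "compose Z Q" and ?T = "compose Z (neg_vec Q)"
  have "?S \<in> topes L" "?T \<in> topes L"
    using compose_tope neg_tope Q assms(2) by auto
  moreover have "e \<in> separation ?S ?T" "f \<notin> separation ?S ?T"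
    using assms(3,5) \<open>Z f \<noteq> 0\<close> by (auto simp: separation_def compose_def neg_vec_def)
  ultimately show False
    using separation_classes_cases[OF assms(1), of ?S ?T] assms(3,4) by blast
qed

text \<open>The classes of parallel elements, that is, the rank-one flats of the underlying matroid,
  each obtained as the zero set of a wall.\<close>

definition classes :: "'a set set" where
  "classes = {separation S T | S T. adjacent L S T}"

lemma class_nonempty: "A \<in> classes \<Longrightarrow> A \<noteq> {}"
proof -
  assume "A \<in> classes"
  then obtain S T where "adjacent L S T" "A = separation S T"
    unfolding classes_def by blast
  then show "A \<noteq> {}"
    using adjacent_topes[of S T] tope_separation[of S T] by (auto simp: fun_eq_iff)
qed

lemma class_cases: "A \<in> classes \<Longrightarrow> S \<in> topes L \<Longrightarrow> T \<in> topes L \<Longrightarrow> A \<subseteq> separation S T \<or> A \<inter> separation S T = {}"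
  unfolding classes_def using separation_classes_cases by blast

lemma class_disjoint:
  assumes "A \<in> classes" "B \<in> classes" "A \<noteq> B"
  shows "A \<inter> B = {}"
proof -
  have "A \<subseteq> B \<or> A \<inter> B = {}" "B \<subseteq> A \<or> A \<inter> B = {}"
    using assms class_cases adjacent_topes unfolding classes_def by (smt (verit) Int_commute mem_Collect_eq)+
  then show ?thesis
    using assms(3) by blast
qed

lemma adjacent_class: "adjacent L S T \<Longrightarrow> separation S T \<in> classes"
  unfolding classes_def by blast

lemma finite_classes: "finite classes"
proof -
  have "classes \<subseteq> Pow E"
    unfolding classes_def using separation_subset_ground tope_covector adjacent_topes by blast
  then show ?thesis
    using finite_ground finite_subset by blast
qed

section \<open>Combinatorial distance and reduced paths\<close>

text \<open>Classes are counted instead of elements because parallel elements change sign in a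
  single step.\<close>

definition tope_dist :: "('a \<Rightarrow> int) \<Rightarrow> ('a \<Rightarrow> int) \<Rightarrow> nat" where
  "tope_dist Q R = card {A \<in> classes. A \<subseteq> separation Q R}"

lemma separation_triangle:
  assumes "Q \<in> topes L" "S \<in> topes L" "R \<in> topes L"
  shows "separation Q R = (separation Q S - separation S R) \<union> (separation S R - separation Q S)"
proof -
  have "Q e \<noteq> R e \<longleftrightarrow> (Q e \<noteq> S e) \<noteq> (S e \<noteq> R e)" for e
  proof (cases "e \<in> E")
    case True
    then have "Q e \<noteq> 0" "S e \<noteq> 0" "R e \<noteq> 0"
      using assms by (auto simp: topes_iff supp_def)
    then show ?thesis
      using covector_values assms tope_covector
      by (smt (verit, ccfv_threshold) insert_iff singletonD)
  next
    case False
    then show ?thesis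
      using assms tope_covector covector_off_ground by metis
  qed
  then show ?thesis
    using assms by (auto simp: tope_separation)
qed

lemma separation_commute_tope: "Q \<in> topes L \<Longrightarrow> R \<in> topes L \<Longrightarrow> separation Q R = separation R Q"
  by (auto simp: tope_separation)

lemma tope_dist_add:
  assumes T: "Q \<in> topes L" "S \<in> topes L" "R \<in> topes L" and sub: "separation Q S \<subseteq> separation Q R"
  shows "tope_dist Q R = tope_dist Q S + tope_dist S R"
proof -
  have SR: "separation S R = separation Q R - separation Q S"
    using separation_triangle[OF T] sub by blast
  have "{A \<in> classes. A \<subseteq> separation Q R} =
    {A \<in> classes. A \<subseteq> separation Q S} \<union> {A \<in> classes. A \<subseteq> separation S R}"
    using sub class_cases[OF _ T(1,2)] unfolding SR by blast
  moreover have "{A \<in> classes. A \<subseteq> separation Q S} \<inter> {A \<in> classes. A \<subseteq> separation S R} = {}"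
    using class_nonempty unfolding SR by blast
  ultimately show ?thesis
    unfolding tope_dist_def using finite_classes by (simp add: card_Un_disjoint)
qed

lemma tope_dist_adjacent:
  assumes "adjacent L Q S"
  shows "tope_dist Q S = 1"
proof -
  have "{A \<in> classes. A \<subseteq> separation Q S} = {separation Q S}"
  proof (intro equalityI subsetI)
    fix A assume A: "A \<in> {A \<in> classes. A \<subseteq> separation Q S}"
    then show "A \<in> {separation Q S}"
      using class_disjoint[of A, OF _ adjacent_class[OF assms]] class_nonempty[of A] by blast
  qed (use adjacent_class[OF assms] in blast)
  then show ?thesis
    by (simp add: tope_dist_def)
qed

lemma tope_dist_step:
  assumes "adjacent L Q S" "R \<in> topes L"
  shows "separation Q S \<subseteq> separation Q R \<and> tope_dist Q R = Suc (tope_dist S R) \<or>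
    separation Q S \<inter> separation Q R = {} \<and> tope_dist S R = Suc (tope_dist Q R)"
proof -
  have QS: "Q \<in> topes L" "S \<in> topes L"
    using assms(1) adjacent_topes by auto
  from separation_classes_cases[OF assms(1) QS(1) assms(2)] show ?thesis
  proof
    assume "separation Q S \<subseteq> separation Q R"
    then show ?thesis
      using tope_dist_add[OF QS assms(2)] tope_dist_adjacent[OF assms(1)] by simp
  next
    assume disj: "separation Q S \<inter> separation Q R = {}"
    then have "separation S Q \<subseteq> separation S R"
      using separation_triangle[OF QS assms(2)] separation_commute_tope[OF QS] by blast
    then have "tope_dist S R = tope_dist S Q + tope_dist Q R"
      using tope_dist_add QS assms(2) by blast
    then show ?thesis
      using tope_dist_adjacent[OF adjacent_sym[OF assms(1)]] disj by simp
  qed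
qed

lemma tope_dist_self [simp]: "Q \<in> topes L \<Longrightarrow> tope_dist Q Q = 0"
  using class_nonempty by (auto simp: tope_dist_def tope_separation card_eq_0_iff)

section \<open>Paths and geodesics\<close>

lemma path_iff:
  "path L Q R p \<longleftrightarrow> p \<noteq> [] \<and> set p \<subseteq> topes L \<and> hd p = Q \<and> last p = R \<and> successively (adjacent L) p"
  by (auto simp: path_def successively_conv_nth)

lemma path_Cons:
  "path L Q R (a # b # p) \<longleftrightarrow> a = Q \<and> adjacent L Q b \<and> path L b R (b # p)"
  by (auto simp: path_iff dest: adjacent_topes)

lemma path_singleton: "path L Q R [a] \<longleftrightarrow> a = Q \<and> a = R \<and> a \<in> topes L"
  by (auto simp: path_iff)

lemma path_hd: "path L Q R (a # p) \<Longrightarrow> a = Q"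
  by (simp add: path_iff)

lemma path_ends: "path L Q R p \<Longrightarrow> Q \<in> topes L \<and> R \<in> topes L"
  by (metis hd_in_set last_in_set path_iff subset_iff)

lemma path_append_iff:
  "path L Q R (us @ S # vs) \<longleftrightarrow> path L Q S (us @ [S]) \<and> path L S R (S # vs)"
proof -
  have "successively (adjacent L) (us @ S # vs) \<longleftrightarrow>
      successively (adjacent L) (us @ [S]) \<and> successively (adjacent L) (S # vs)"
    by (auto simp: successively_append_iff)
  moreover have "hd (us @ S # vs) = hd (us @ [S])"
    by (cases us) auto
  ultimately show ?thesis
    unfolding path_iff by auto
qed

text \<open>A form of \<open>reduced_path\<close> that avoids comparison with all other paths;
  \<open>Suc\<close> accounts for a list having one more entry than the path has steps.\<close>

definition geodesic :: "('a \<Rightarrow> int) \<Rightarrow> ('a \<Rightarrow> int) \<Rightarrow> ('a \<Rightarrow> int) list \<Rightarrow> bool" where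
  "geodesic Q R p \<longleftrightarrow> path L Q R p \<and> length p = Suc (tope_dist Q R)"

lemma tope_dist_less_length: "path L Q R p \<Longrightarrow> tope_dist Q R < length p"
proof (induction p arbitrary: Q)
  case (Cons a p)
  show ?case
  proof (cases p)
    case Nil
    with Cons.prems have "Q = R" "Q \<in> topes L"
      by (auto simp: path_singleton)
    then show ?thesis
      by simp
  next
    case (Cons b p')
    then have b: "adjacent L Q b" "path L b R p"
      using Cons.prems by (auto simp: path_Cons)
    then show ?thesis
      using Cons.IH[OF b(2)] tope_dist_step[OF b(1)] path_ends[OF b(2)] by fastforce
  qed
qed (simp add: path_iff)

lemma geodesic_Cons:
  "geodesic Q R (a # b # p) \<longleftrightarrow>
    a = Q \<and> adjacent L Q b \<and> separation Q b \<subseteq> separation Q R \<and> geodesic b R (b # p)"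
proof (cases "a = Q \<and> adjacent L Q b \<and> path L b R (b # p)")
  case True
  \<comment> \<open>This makes the two alternatives of \<open>tope_dist_step\<close> exclusive, as
    an empty set would be both contained and disjoint.\<close>
  have "separation Q b \<noteq> {}"
    using True adjacent_class class_nonempty by blast
  then show ?thesis
    using True tope_dist_step[of Q b R] path_ends[of b R "b # p"] tope_dist_less_length[of b R "b # p"]
    unfolding geodesic_def path_Cons by auto
qed (auto simp: geodesic_def path_Cons)

lemma geodesic_singleton: "Q \<in> topes L \<Longrightarrow> geodesic Q Q [Q]"
  by (simp add: geodesic_def path_singleton)

lemma ex_geodesic:
  assumes "Q \<in> topes L" "R \<in> topes L"
  obtains p where "geodesic Q R (Q # p)"
proof -
  have "\<exists>p. geodesic Q R (Q # p)"
    using assms(1)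
  proof (induction "tope_dist Q R" arbitrary: Q rule: less_induct)
    case less
    show ?case
    proof (cases "Q = R")
      case True
      then show ?thesis
        using geodesic_singleton less.prems by blast
    next
      case False
      then obtain S where S: "adjacent L Q S" "separation Q S \<subseteq> separation Q R"
        using ex_adjacent_towards less.prems assms(2) by metis
      have "tope_dist S R < tope_dist Q R"
        using tope_dist_add[OF less.prems _ assms(2) S(2)] tope_dist_adjacent[OF S(1)] adjacent_topes[OF S(1)]
        by simp
      then show ?thesis
        using less.hyps S adjacent_topes[OF S(1)] by (metis geodesic_Cons)
    qed
  qed
  then show thesis
    using that by blast
qed

lemma reduced_path_iff_geodesic: "reduced_path L Q R p \<longleftrightarrow> geodesic Q R p"
proof
  assume red: "reduced_path L Q R p"
  then have p: "path L Q R p"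
    by (simp add: reduced_path_def)
  obtain q where "geodesic Q R (Q # q)"
    using ex_geodesic path_ends[OF p] by metis
  then show "geodesic Q R p"
    using red tope_dist_less_length[OF p]
    by (fastforce simp: reduced_path_def geodesic_def path_length_def)
next
  assume "geodesic Q R p"
  then show "reduced_path L Q R p"
    using tope_dist_less_length by (fastforce simp: reduced_path_def geodesic_def path_length_def)
qed

lemma geodesic_separation_mono:
  "geodesic Q R (us @ S # vs) \<Longrightarrow> separation Q S \<subseteq> separation Q R"
proof (induction us arbitrary: Q)
  case Nil
  then have "S = Q" "Q \<in> topes L"
    using path_ends by (auto simp: geodesic_def dest: path_hd)
  then show ?case
    by (simp add: tope_separation)
next
  case (Cons a us)
  obtain b where b: "adjacent L Q b" "separation Q b \<subseteq> separation Q R" "geodesic b R (us @ S # vs)"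
    using Cons.prems by (cases us) (auto simp: geodesic_Cons)
  have bp: "path L b S (us @ [S])" "path L S R (S # vs)"
    using b(3) path_append_iff[of b R us S vs] by (simp_all add: geodesic_def)
  have T: "Q \<in> topes L" "b \<in> topes L" "R \<in> topes L" "S \<in> topes L"
    using adjacent_topes[OF b(1)] path_ends[OF bp(1)] path_ends[OF bp(2)] by simp_all
  have "separation b S \<subseteq> separation b R"
    using Cons.IH[OF b(3)] .
  then show ?case
    using b(2) separation_triangle[OF T(1,2,3)] separation_triangle[OF T(1,2,4)] by blast
qed

text \<open>The distances of the two pieces add up and neither piece can be shorter than its
  distance, so the whole is tight iff both pieces are.\<close>

lemma geodesic_append_iff:
  "geodesic Q R (us @ S # vs) \<longleftrightarrow>
    separation Q S \<subseteq> separation Q R \<and> geodesic Q S (us @ [S]) \<and> geodesic S R (S # vs)"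
proof (cases "path L Q R (us @ S # vs) \<and> separation Q S \<subseteq> separation Q R")
  case True
  then have p: "path L Q S (us @ [S])" "path L S R (S # vs)"
    using path_append_iff[of Q R us S vs] by simp_all
  have "tope_dist Q R = tope_dist Q S + tope_dist S R"
    using tope_dist_add path_ends[OF p(1)] path_ends[OF p(2)] True by blast
  then show ?thesis
    using True p tope_dist_less_length[OF p(1)] tope_dist_less_length[OF p(2)]
    by (auto simp: geodesic_def)
next
  case False
  then show ?thesis
    using geodesic_separation_mono[of Q R us S vs] path_append_iff[of Q R us S vs]
    by (auto simp: geodesic_def)
qed

lemma geodesic_distinct: "geodesic Q R p \<Longrightarrow> distinct p"
proof (induction p arbitrary: Q)
  case (Cons a p)
  have a: "a = Q" "Q \<in> topes L"
    using Cons.prems path_ends by (auto simp: geodesic_def dest: path_hd)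
  have "Q \<notin> set p"
  proof
    assume "Q \<in> set p"
    then obtain us vs where "p = us @ Q # vs"
      by (meson split_list)
    then have "geodesic Q Q ((Q # us) @ [Q])"
      using Cons.prems a geodesic_append_iff[of Q R "Q # us" Q vs] by simp
    then show False
      using a by (simp add: geodesic_def)
  qed
  moreover have "distinct p"
    using Cons by (cases p) (auto simp: geodesic_Cons)
  ultimately show ?case
    using a by simp
qed simp

text \<open>The decomposition is taken at the first crossing of \<open>A\<close>; the disjointness
  from \<open>separation Q S\<close> records that \<open>A\<close> has not been crossed
  before.\<close>

lemma path_crosses_class:
  assumes "path L Q R p" "A \<in> classes" "A \<subseteq> separation Q R"
  obtains us S T vs where "p = us @ S # T # vs" "separation S T = A" "A \<inter> separation Q S = {}"
proof -
  have "\<exists>us S T vs. p = us @ S # T # vs \<and> separation S T = A \<and> A \<inter> separation Q S = {}"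
    using assms
  proof (induction p arbitrary: Q)
    case (Cons a p)
    have ne: "A \<noteq> {}"
      using Cons.prems(2) class_nonempty by blast
    have T: "Q \<in> topes L" "R \<in> topes L"
      using Cons.prems path_ends by auto
    show ?case
    proof (cases p)
      case Nil
      then show ?thesis
        using Cons.prems ne T by (auto simp: path_singleton tope_separation)
    next
      case (Cons b p')
      then have b: "a = Q" "adjacent L Q b" "path L b R p"
        using Cons.prems by (auto simp: path_Cons)
      show ?thesis
      proof (cases "separation Q b = A")
        case True
        then have "a # p = [] @ Q # b # p' \<and> separation Q b = A \<and> A \<inter> separation Q Q = {}"
          using b T Cons by (auto simp: tope_separation)
        then show ?thesis
          by blast
      next
        case False
        have bt: "b \<in> topes L"
          using b(2) adjacent_topes by blast
        have disj: "separation Q b \<inter> A = {}"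
          using class_disjoint[OF adjacent_class[OF b(2)] Cons.prems(2) False] .
        have "A \<subseteq> separation b R"
          using separation_triangle[OF T(1) bt T(2)] disj Cons.prems(3) by blast
        then obtain us S T' vs where *: "p = us @ S # T' # vs" "separation S T' = A" "A \<inter> separation b S = {}"
          using Cons.IH[OF b(3) Cons.prems(2)] by blast
        have "S \<in> topes L"
          using b(3) * by (auto simp: path_iff)
        then have "A \<inter> separation Q S = {}"
          using separation_triangle[OF T(1) bt] disj *(3) by blast
        then have "a # p = (a # us) @ S # T' # vs \<and> separation S T' = A \<and> A \<inter> separation Q S = {}"
          using * by simp
        then show ?thesis
          by blast
      qed
    qed
  qed (simp add: path_iff)
  then show thesis
    using that by blast
qed

section \<open>Covectors of corank two\<close>

text \<open>The antipodal map among the covectors above \<open>G\<close>. For \<open>G\<close> of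
  corank two it sends each tope of the polygon to the opposite one.\<close>

definition reflect :: "('a \<Rightarrow> int) \<Rightarrow> ('a \<Rightarrow> int) \<Rightarrow> 'a \<Rightarrow> int" where
  "reflect G X = compose G (neg_vec X)"

lemma reflect_apply: "reflect G X e = (if e \<in> supp G then G e else - X e)"
  by (simp add: reflect_def compose_def neg_vec_def supp_def)

lemma reflect_covector: "G \<in> L \<Longrightarrow> X \<in> L \<Longrightarrow> reflect G X \<in> L"
  by (simp add: reflect_def compose_covector neg_covector)

lemma face_le_reflect: "G \<preceq> reflect G X"
  by (simp add: reflect_def face_le_compose)

lemma supp_reflect: "G \<preceq> X \<Longrightarrow> supp (reflect G X) = supp X"
  using face_le_supp by (auto simp: reflect_def supp_compose)

lemma reflect_tope: "G \<in> L \<Longrightarrow> T \<in> topes L \<Longrightarrow> reflect G T \<in> topes L"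
  by (simp add: reflect_def compose_tope neg_tope)

lemma reflect_reflect: "G \<preceq> X \<Longrightarrow> reflect G (reflect G X) = X"
  using face_leD[of G X] by (auto simp: reflect_apply supp_def fun_eq_iff)

lemma reflect_mono: "F \<preceq> X \<Longrightarrow> reflect G F \<preceq> reflect G X"
  using face_leD[of F X] by (intro face_leI) (auto simp: reflect_apply split: if_splits)

text \<open>The wall between \<open>S\<close> and \<open>T\<close> lies above \<open>G\<close>,
  since both agree with \<open>G\<close> on its support. Reflecting the wall preserves its support
  and therefore its rank.\<close>

lemma adjacent_reflect:
  assumes "G \<in> L" "G \<preceq> S" "G \<preceq> T" "adjacent L S T"
  shows "adjacent L (reflect G S) (reflect G T)"
proof -
  obtain F where F: "F \<in> L" "cov_rank L F + 1 = om_rank L" "F \<preceq> S" "F \<preceq> T"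
    "separation S T = E - supp F"
    using adjacent_wall[OF assms(4)] by metis
  have ST: "S \<in> topes L" "T \<in> topes L" "S \<noteq> T"
    using adjacent_topes[OF assms(4)] by auto
  have "e \<notin> separation S T" if "e \<in> supp G" for e
    using that face_leD[OF assms(2), of e] face_leD[OF assms(3), of e] by (auto simp: separation_def supp_def)
  then have "supp G \<subseteq> supp F"
    using F(5) supp_subset_ground[OF assms(1)] by blast
  then have "G \<preceq> F"
    using face_le_restrict assms(2) F(3) by blast
  then have "cov_rank L (reflect G F) + 1 = om_rank L"
    using F(2) cov_rank_supp_eq[OF reflect_covector[OF assms(1) F(1)] F(1) supp_reflect] by simp
  moreover have "reflect G S \<noteq> reflect G T"
    using reflect_reflect[OF assms(2)] reflect_reflect[OF assms(3)] ST(3) by metis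
  ultimately show ?thesis
    unfolding adjacent_def
    using reflect_mono[OF F(3)] reflect_mono[OF F(4)] reflect_covector[OF assms(1) F(1)]
      reflect_tope[OF assms(1)] ST by blast
qed

text \<open>Its use is convexity: a geodesic between two topes above \<open>G\<close> never leaves
  the topes above \<open>G\<close>.\<close>

lemma above_iff_separation:
  assumes "Q \<in> topes L" "T \<in> topes L" "G \<preceq> Q"
  shows "G \<preceq> T \<longleftrightarrow> separation Q T \<subseteq> E - supp G"
proof -
  have "G \<preceq> T \<longleftrightarrow> (\<forall>e\<in>supp G. Q e = T e)"
  proof
    assume "\<forall>e\<in>supp G. Q e = T e"
    then show "G \<preceq> T"
      using face_leD[OF assms(3)] by (intro face_leI) (simp add: supp_def)
  qed (use face_leD[OF assms(3)] face_leD[of G T] in \<open>simp add: supp_def\<close>)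
  also have "\<dots> \<longleftrightarrow> separation Q T \<subseteq> E - supp G"
    using separation_subset_ground[OF tope_covector[OF assms(1)], of T] tope_separation[OF assms(1,2)] by auto
  finally show ?thesis .
qed

lemma separation_reflect:
  assumes "Q \<in> topes L" "T \<in> topes L" "G \<in> L" "G \<preceq> Q" "G \<preceq> T"
  shows "separation Q (reflect G T) = E - supp G - separation Q T"
proof -
  have "Q e = reflect G T e \<longleftrightarrow> e \<notin> E - supp G - separation Q T" for e
  proof (cases "e \<in> E - supp G")
    case True
    then have "Q e \<noteq> 0" "T e \<noteq> 0"
      using assms(1,2) by (auto simp: topes_iff supp_def)
    then show ?thesis
      using True covector_values[OF tope_covector[OF assms(1)], of e]
        covector_values[OF tope_covector[OF assms(2)], of e]
      by (auto simp: reflect_apply separation_def)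
  next
    case False
    then show ?thesis
      using face_leD[OF assms(4), of e] covector_off_ground[OF tope_covector[OF assms(1)], of e]
        covector_off_ground[OF tope_covector[OF assms(2)], of e]
      by (auto simp: reflect_apply supp_def)
  qed
  then show ?thesis
    using tope_separation[OF assms(1) reflect_tope[OF assms(3,2)]] by blast
qed

lemma separation_inj:
  assumes "Q \<in> topes L" "S \<in> topes L" "T \<in> topes L" "separation Q S = separation Q T"
  shows "S = T"
proof -
  have "separation S T = {}"
    using separation_triangle[OF assms(2,1,3)] assms(4) separation_commute_tope[OF assms(1,2)] by auto
  then show ?thesis
    using tope_separation[OF assms(2,3)] by auto
qed

text \<open>With three neighbours, eliminating an element \<open>a3\<close> of the third class
  between the first wall and the reflected second wall gives \<open>Z\<close> above
  \<open>G\<close>, opposite to \<open>Q\<close> at \<open>a1\<close> and equal to \<open>Q\<close>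
  at \<open>a2\<close>. It vanishes on the third class, so it has the support of the third wall
  \<open>F3\<close> and \<open>G\<close> as a facet. Then \<open>Z\<close> and \<open>F3\<close>
  must be opposite outside \<open>supp G\<close>, but they agree at \<open>a2\<close>.\<close>

lemma at_most_two_neighbours:
  assumes G: "G \<in> L" "cov_rank L G + 2 = om_rank L" "G \<preceq> Q"
    and T1: "adjacent L Q T1" "G \<preceq> T1" and T2: "adjacent L Q T2" "G \<preceq> T2" and T3: "adjacent L Q T3" "G \<preceq> T3"
    and ne: "T1 \<noteq> T2" "T1 \<noteq> T3" "T2 \<noteq> T3"
  shows False
proof -
  have Q: "Q \<in> topes L"
    using T1 adjacent_topes by blast
  have Q0: "Q e \<noteq> 0 \<longleftrightarrow> e \<in> E" for e
    using tope_supp[OF Q] by (auto simp: supp_def)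
  have wall: "\<exists>F\<in>L. cov_rank L F + 1 = om_rank L \<and> G \<preceq> F \<and> (\<forall>e. F e = (if e \<in> separation Q T then 0 else Q e))
      \<and> separation Q T \<subseteq> E - supp G"
    if T: "adjacent L Q T" "G \<preceq> T" for T
  proof -
    obtain F where F: "F \<in> L" "cov_rank L F + 1 = om_rank L" "F \<preceq> Q" "F \<preceq> T"
      "separation Q T = E - supp F"
      using adjacent_wall[OF T(1)] by metis
    have sub: "separation Q T \<subseteq> E - supp G"
      using above_iff_separation Q adjacent_topes[OF T(1)] G(3) T(2) by blast
    then have "supp G \<subseteq> supp F"
      using F(5) supp_subset_ground[OF G(1)] by blast
    then have "G \<preceq> F"
      using face_le_restrict G(3) F(3) by blast
    moreover have "F e = (if e \<in> separation Q T then 0 else Q e)" for e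
    proof (cases "e \<in> supp F")
      case True
      then show ?thesis
        using F(5) face_leD[OF F(3), of e] by (simp add: supp_def)
    next
      case False
      then show ?thesis
        using F(5) Q0[of e] by (auto simp: supp_def)
    qed
    ultimately show ?thesis
      using F sub by blast
  qed
  obtain F1 where F1: "F1 \<in> L" "G \<preceq> F1" "\<And>e. F1 e = (if e \<in> separation Q T1 then 0 else Q e)"
    using wall[OF T1] by blast
  obtain F2 where F2: "F2 \<in> L" "G \<preceq> F2" "\<And>e. F2 e = (if e \<in> separation Q T2 then 0 else Q e)"
    using wall[OF T2] by blast
  obtain F3 where F3: "F3 \<in> L" "G \<preceq> F3" "\<And>e. F3 e = (if e \<in> separation Q T3 then 0 else Q e)"
    "cov_rank L F3 + 1 = om_rank L"
    using wall[OF T3] by blast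
  have sub: "separation Q T1 \<subseteq> E - supp G" "separation Q T2 \<subseteq> E - supp G" "separation Q T3 \<subseteq> E - supp G"
    using wall T1 T2 T3 by blast+
  have cls: "separation Q T1 \<in> classes" "separation Q T2 \<in> classes" "separation Q T3 \<in> classes"
    using T1 T2 T3 adjacent_class by auto
  have "separation Q T1 \<noteq> separation Q T2" "separation Q T1 \<noteq> separation Q T3" "separation Q T2 \<noteq> separation Q T3"
    using separation_inj[OF Q] ne adjacent_topes T1 T2 T3 by blast+
  then have disj: "separation Q T1 \<inter> separation Q T2 = {}" "separation Q T1 \<inter> separation Q T3 = {}"
    "separation Q T2 \<inter> separation Q T3 = {}"
    using class_disjoint cls by auto
  obtain a1 a2 a3 where a: "a1 \<in> separation Q T1" "a2 \<in> separation Q T2" "a3 \<in> separation Q T3"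
    using class_nonempty[OF cls(1)] class_nonempty[OF cls(2)] class_nonempty[OF cls(3)] by blast
  have aE: "a1 \<in> E - supp G" "a2 \<in> E - supp G" "a3 \<in> E - supp G"
    using a sub by auto
  have a_notin: "a1 \<notin> separation Q T2" "a1 \<notin> separation Q T3" "a2 \<notin> separation Q T1" "a2 \<notin> separation Q T3"
    "a3 \<notin> separation Q T1" "a3 \<notin> separation Q T2"
    using a disj by auto
  let ?F2 = "reflect G F2"
  have F2': "?F2 \<in> L"
    using reflect_covector G(1) F2(1) by blast
  have "a3 \<in> separation F1 ?F2"
    using a_notin aE Q0 by (simp add: separation_def reflect_apply F1(3) F2(3))
  then obtain Z where Z: "Z \<in> L" "Z a3 = 0"
    "\<forall>f\<in>E - separation F1 ?F2. Z f = compose F1 ?F2 f \<and> Z f = compose ?F2 F1 f"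
    using covector_elimination[OF F1(1) F2'] by blast
  have Z1: "Z a1 = - Q a1" and Z2: "Z a2 = Q a2"
  proof -
    have "a1 \<in> E - separation F1 ?F2" "a2 \<in> E - separation F1 ?F2"
      using a a_notin aE Q0 by (auto simp: separation_def reflect_apply F1(3) F2(3))
    then have "Z a1 = compose F1 ?F2 a1" "Z a2 = compose F1 ?F2 a2"
      using Z(3) by blast+
    then show "Z a1 = - Q a1" "Z a2 = Q a2"
      using a a_notin aE Q0 by (auto simp: compose_def reflect_apply F1(3) F2(3))
  qed
  have GZ: "G \<preceq> Z"
  proof (rule face_leI)
    fix e assume e: "G e \<noteq> 0"
    then have "F1 e = G e" "?F2 e = G e" "e \<in> E"
      using face_leD[OF F1(2)] supp_subset_ground[OF G(1)] by (auto simp: reflect_apply supp_def)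
    moreover from this have "e \<notin> separation F1 ?F2"
      using e by (simp add: separation_def)
    ultimately show "Z e = G e"
      using Z(3) e by (auto simp: compose_def)
  qed
  have "Z e = 0" if "e \<in> separation Q T3" for e
    using covector_zero_on_class[OF T3(1) Z(1) a(3) that Z(2)] .
  then have ZF3: "supp Z \<subseteq> supp F3"
    using supp_subset_ground[OF Z(1)] Q0 by (auto simp: supp_def F3(3))
  have "Z \<noteq> G"
    using Z1 aE(1) Q0[of a1] by (auto simp: supp_def)
  then have "cov_rank L G < cov_rank L Z"
    using cov_rank_less G(1) Z(1) GZ by metis
  then have "\<not> supp Z \<subset> supp F3"
    using cov_rank_supp_less[OF Z(1) F3(1)] F3(4) G(2) by auto
  then have ZF3: "supp Z = supp F3"
    using ZF3 by blast
  have "Z \<noteq> F3"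
    using Z1 F3(3)[of a1] a_notin(2) Q0[of a1] aE(1) by auto
  moreover have "cov_rank L G + 1 = cov_rank L Z"
    using cov_rank_supp_eq[OF Z(1) F3(1) ZF3] F3(4) G(2) by simp
  ultimately have "separation Z F3 = supp Z - supp G"
    using separation_over_facet[OF G(1) Z(1) F3(1) ZF3 GZ F3(2)] by blast
  moreover have "a2 \<in> supp Z - supp G"
    using Z2 aE Q0 by (auto simp: supp_def)
  ultimately have "a2 \<in> separation Z F3"
    by blast
  then show False
    using Z2 F3(3)[of a2] a_notin(4) by (simp add: separation_def)
qed

lemma separation_proper:
  assumes "G \<in> L" "cov_rank L G + 2 = om_rank L" "adjacent L Q S"
  shows "separation Q S \<noteq> E - supp G"
proof
  assume eq: "separation Q S = E - supp G"
  obtain F where F: "F \<in> L" "cov_rank L F + 1 = om_rank L" "separation Q S = E - supp F"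
    using adjacent_wall[OF assms(3)] by metis
  then have "supp F = supp G"
    using eq supp_subset_ground assms(1) by blast
  then show False
    using cov_rank_supp_eq[OF F(1) assms(1)] F(2) assms(2) by simp
qed

text \<open>The reflection of \<open>Q1\<close> is separated from \<open>Q\<close> by exactly the
  elements outside \<open>supp G\<close> that \<open>Q1\<close> leaves uncrossed; a step towards it
  starts the other way around \<open>G\<close>.\<close>

lemma ex_other_neighbour:
  assumes G: "G \<in> L" "cov_rank L G + 2 = om_rank L" "G \<preceq> Q" and Q1: "adjacent L Q Q1" "G \<preceq> Q1"
  obtains Q2 where "adjacent L Q Q2" "G \<preceq> Q2" "separation Q Q2 \<inter> separation Q Q1 = {}" "Q2 \<noteq> Q1"
proof -
  have T: "Q \<in> topes L" "Q1 \<in> topes L"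
    using Q1 adjacent_topes by auto
  let ?R = "reflect G Q1"
  have R: "?R \<in> topes L" "separation Q ?R = E - supp G - separation Q Q1"
    using reflect_tope separation_reflect G Q1 T by auto
  have "separation Q Q1 \<subseteq> E - supp G"
    using above_iff_separation[OF T G(3)] Q1(2) by blast
  then have "separation Q ?R \<noteq> {}"
    using R(2) separation_proper[OF G(1,2) Q1(1)] by blast
  then have "Q \<noteq> ?R"
    using tope_separation[OF T(1) R(1)] by auto
  then obtain Q2 where Q2: "adjacent L Q Q2" "separation Q Q2 \<subseteq> separation Q ?R"
    using ex_adjacent_towards T(1) R(1) by metis
  moreover have "G \<preceq> Q2"
    using above_iff_separation[OF T(1) _ G(3)] Q2 R(2) adjacent_topes by blast
  moreover have "separation Q Q2 \<inter> separation Q Q1 = {}"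
    using Q2(2) R(2) by blast
  moreover from this have "Q2 \<noteq> Q1"
    using class_nonempty[OF adjacent_class[OF Q1(1)]] by blast
  ultimately show thesis
    using that by blast
qed

end

section \<open>The cycle of topes around a corank-two covector\<close>

lemma successively_cyclic:
  assumes "successively P (xs @ [hd xs])" "i < length xs"
  shows "P (xs ! i) (xs ! (Suc i mod length xs))"
proof -
  have "P ((xs @ [hd xs]) ! i) ((xs @ [hd xs]) ! Suc i)"
    using assms by (simp add: successively_conv_nth del: successively_append_iff)
  moreover have "hd xs = xs ! 0"
    using assms(2) by (intro hd_conv_nth) auto
  ultimately show ?thesis
    using assms(2) by (cases "Suc i = length xs") (auto simp: nth_append)
qed

lemma cyclic_neighbours_distinct:
  assumes "distinct xs" "3 \<le> length xs" "x \<in> set xs"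
  obtains i j where "i < length xs" "j < length xs" "x = xs ! (Suc i mod length xs)" "x = xs ! j"
    "xs ! i \<noteq> xs ! (Suc j mod length xs)"
proof -
  obtain j where j: "j < length xs" "x = xs ! j"
    using assms(3) by (metis in_set_conv_nth)
  \<comment> \<open>The cyclic predecessor, wrapping around at \<open>0\<close>. It differs from the
    successor because there are at least three entries.\<close>
  let ?i = "if j = 0 then length xs - 1 else j - 1"
  have "?i < length xs" "Suc ?i mod length xs = j"
    using j(1) assms(2) by auto
  moreover have "?i \<noteq> Suc j mod length xs"
    using j(1) assms(2) by (cases "Suc j = length xs") auto
  moreover have "Suc j mod length xs < length xs"
    using j(1) by (intro mod_less_divisor) linarith
  ultimately show thesis
    using that[of ?i j] j nth_eq_iff_index_eq[OF assms(1)] by metis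
qed

context loopless_oriented_matroid
begin

text \<open>A geodesic from \<open>Q\<close> through \<open>Q1\<close> to the antipode of
  \<open>Q\<close>, followed by its reflection, closes up to a cycle. Since each tope has at most
  two neighbours above \<open>G\<close>, the cycle exhausts the topes above \<open>G\<close>. Its
  second half read backwards is the geodesic through \<open>Q2\<close>.\<close>

lemma ex_polygon:
  assumes G: "G \<in> L" "cov_rank L G + 2 = om_rank L" "G \<preceq> Q"
    and Q1: "adjacent L Q Q1" "G \<preceq> Q1" and Q2: "adjacent L Q Q2" "G \<preceq> Q2" and "Q1 \<noteq> Q2"
  obtains xs ys where
    "polygon L ([Q] @ (Q1 # xs) @ [reflect G Q] @ rev (Q2 # ys))"
    "geodesic Q (reflect G Q) (Q # (Q1 # xs) @ [reflect G Q])"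
    "geodesic Q (reflect G Q) (Q # (Q2 # ys) @ [reflect G Q])"
proof -
  let ?O = "reflect G Q" and ?r = "reflect G"
  have T: "Q \<in> topes L" "Q1 \<in> topes L" "?O \<in> topes L"
    using Q1 adjacent_topes reflect_tope[OF G(1)] by auto
  have sepO: "separation Q ?O = E - supp G"
    using separation_reflect[OF T(1,1) G(1,3,3)] by (auto simp: tope_separation[OF T(1,1)])
  have rO: "?r ?O = Q"
    using reflect_reflect G(3) by blast
  let ?A = "separation Q Q1"
  have A: "?A \<subseteq> separation Q ?O" "?A \<noteq> {}" "?A \<noteq> separation Q ?O"
    using above_iff_separation[OF T(1,2) G(3)] Q1(2) sepO class_nonempty[OF adjacent_class[OF Q1(1)]]
      separation_proper[OF G(1,2) Q1(1)] by auto
  obtain p where p: "geodesic Q1 ?O (Q1 # p)"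
    using ex_geodesic T by blast
  have "Q1 \<noteq> ?O"
    using A(3) by auto
  then have "p \<noteq> []" "last p = ?O"
    using p by (auto simp: geodesic_def path_iff split: if_splits)
  then obtain xs where xs: "p = xs @ [?O]"
    by (metis append_butlast_last_id)
  \<comment> \<open>The antipode is left out here because it is the first entry of the reflected
    half \<open>map ?r W\<close>.\<close>
  define W where "W = Q # Q1 # xs"
  have X: "geodesic Q ?O (W @ [?O])"
    using p Q1(1) A(1) unfolding xs W_def by (simp add: geodesic_Cons)
  have W_T: "S \<in> topes L" and W_sep: "separation Q S \<subseteq> separation Q ?O" if S: "S \<in> set (W @ [?O])" for S
  proof -
    show "S \<in> topes L"
      using S X unfolding geodesic_def path_iff by blast
    obtain us vs where us: "W @ [?O] = us @ S # vs"
      using S by (meson split_list)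
    show "separation Q S \<subseteq> separation Q ?O"
      using geodesic_separation_mono[of Q ?O us S vs] X us by simp
  qed
  have W_above: "G \<preceq> S" if "S \<in> set (W @ [?O])" for S
    using above_iff_separation[OF T(1) W_T[OF that] G(3)] W_sep[OF that] sepO by simp
  have A_sub: "?A \<subseteq> separation Q S" if S: "S \<in> set (Q1 # xs @ [?O])" for S
  proof -
    obtain us vs where us: "Q1 # xs @ [?O] = us @ S # vs"
      using S by (meson split_list)
    then have "separation Q1 S \<subseteq> separation Q1 ?O"
      using geodesic_separation_mono[of Q1 ?O us S vs] p xs by simp
    moreover have ST: "S \<in> topes L"
      using W_T S by (auto simp: W_def)
    ultimately show ?thesis
      using separation_triangle[OF T(1,2,3)] separation_triangle[OF T(1,2) ST] A(1) by blast
  qed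
  \<comment> \<open>The class \<open>?A\<close> tells the halves apart: it is crossed throughout
    \<open>Q1 # xs\<close> and uncrossed throughout its reflection.\<close>
  have A_disj: "?A \<inter> separation Q (?r S) = {}" if S: "S \<in> set (Q1 # xs)" for S
    using A_sub[of S] separation_reflect[OF T(1) W_T G(1,3) W_above] S by (auto simp: W_def)
  let ?Cs = "W @ map ?r W"
  have distX: "distinct (W @ [?O])"
    using geodesic_distinct[OF X] .
  have inj: "inj_on ?r (set W)"
    by (rule inj_on_inverseI[of _ ?r]) (simp add: reflect_reflect W_above)
  have disj: "?r S \<notin> set W" if S: "S \<in> set W" for S
  proof (cases "S = Q")
    case True
    then show ?thesis
      using distX by simp
  next
    case False
    then have S': "S \<in> set (Q1 # xs)"
      using S by (simp add: W_def)
    have "?r S \<notin> set (Q1 # xs)"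
      using A_disj[OF S'] A_sub[of "?r S"] A(2) by auto
    moreover have "?r S \<noteq> Q"
    proof
      assume "?r S = Q"
      then have "S = ?O"
        using reflect_reflect[OF W_above, of S] S by auto
      then show False
        using distX S by simp
    qed
    ultimately show ?thesis
      by (simp add: W_def)
  qed
  have dist: "distinct ?Cs"
    using distX inj disj by (auto simp: distinct_map)
  have "path L ?O Q (map ?r (W @ [?O]))"
  proof -
    have "successively (adjacent L) (W @ [?O])"
      using X unfolding geodesic_def path_iff by blast
    then have "successively (\<lambda>S T. adjacent L (?r S) (?r T)) (W @ [?O])"
      by (rule successively_mono) (use adjacent_reflect[OF G(1)] W_above in blast)
    then have "successively (adjacent L) (map ?r (W @ [?O]))"
      by (simp only: successively_map)
    moreover have "set (map ?r (W @ [?O])) \<subseteq> topes L"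
      using W_T reflect_tope[OF G(1)] by auto
    ultimately show ?thesis
      unfolding path_iff by (simp add: W_def rO)
  qed
  then have Y: "path L ?O Q (?O # map ?r (Q1 # xs) @ [Q])"
    by (simp add: W_def rO)
  have "path L Q Q (W @ ?O # map ?r (Q1 # xs) @ [Q])"
    using path_append_iff X Y unfolding geodesic_def by blast
  then have "path L Q Q (?Cs @ [Q])"
    by (simp add: W_def)
  then have "successively (adjacent L) (?Cs @ [hd ?Cs])"
    unfolding path_iff by (simp add: W_def)
  then have cyc: "adjacent L (?Cs ! i) (?Cs ! (Suc i mod length ?Cs))" if "i < length ?Cs" for i
    using successively_cyclic that by blast
  have Cs_T: "S \<in> topes L" "G \<preceq> S" if "S \<in> set ?Cs" for S
    using that W_T W_above reflect_tope[OF G(1)] face_le_reflect by auto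
  have len: "3 \<le> length ?Cs"
    by (simp add: W_def)
  \<comment> \<open>A neighbour of \<open>S\<close> nearer to \<open>Q\<close> is on the cycle by
    induction. Its two cycle neighbours are all its neighbours above \<open>G\<close>, so
    \<open>S\<close> is one of them.\<close>
  have all: "S \<in> set ?Cs" if "S \<in> topes L" "G \<preceq> S" for S
    using that
  proof (induction "tope_dist S Q" arbitrary: S rule: less_induct)
    case less
    show ?case
    proof (cases "S = Q")
      case False
      then obtain S' where S': "adjacent L S S'" "separation S S' \<subseteq> separation S Q"
        using ex_adjacent_towards less.prems(1) T(1) by metis
      have S'T: "S' \<in> topes L"
        using S'(1) adjacent_topes by blast
      have "separation S Q \<subseteq> E - supp G"
        using above_iff_separation[OF less.prems(1) T(1) less.prems(2)] G(3) by blast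
      then have "G \<preceq> S'"
        using above_iff_separation[OF less.prems(1) S'T less.prems(2)] S'(2) by blast
      moreover have "tope_dist S' Q < tope_dist S Q"
        using tope_dist_add[OF less.prems(1) S'T T(1) S'(2)] tope_dist_adjacent[OF S'(1)] by simp
      ultimately have "S' \<in> set ?Cs"
        using less.hyps S'T by blast
      then obtain i j where ij: "i < length ?Cs" "j < length ?Cs" "S' = ?Cs ! (Suc i mod length ?Cs)"
        "S' = ?Cs ! j" "?Cs ! i \<noteq> ?Cs ! (Suc j mod length ?Cs)"
        by (rule cyclic_neighbours_distinct[OF dist len])
      have "Suc j mod length ?Cs < length ?Cs"
        using ij(2) by (intro mod_less_divisor) linarith
      from nth_mem[OF ij(1)] nth_mem[OF this]
      have in_Cs: "?Cs ! i \<in> set ?Cs" "?Cs ! (Suc j mod length ?Cs) \<in> set ?Cs" .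
      have "adjacent L S' (?Cs ! i)" "adjacent L S' (?Cs ! (Suc j mod length ?Cs))"
        using cyc[OF ij(1)] cyc[OF ij(2)] ij(3,4) adjacent_sym by auto
      then have "S = ?Cs ! i \<or> S = ?Cs ! (Suc j mod length ?Cs)"
        using at_most_two_neighbours[OF G(1,2) \<open>G \<preceq> S'\<close>] ij(5) adjacent_sym[OF S'(1)] less.prems(2) Cs_T(2) in_Cs
        by metis
      then show ?thesis
        using in_Cs by auto
    qed (simp add: W_def)
  qed
  have poly: "polygon L ?Cs"
    unfolding polygon_def
  proof (intro conjI bexI[of _ G])
    show "set ?Cs = {T \<in> topes L. G \<preceq> T}"
      using all Cs_T by blast
  qed (use len dist cyc G in auto)
  define ys where "ys = rev (map ?r (Q1 # xs))"
  have "path L Q ?O (rev (map ?r (W @ [?O])))"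
  proof -
    have "path L ?O Q (map ?r (W @ [?O]))"
      using Y by (simp add: W_def rO)
    then show ?thesis
      unfolding path_iff successively_rev
      by (auto simp: hd_rev last_rev adjacent_sym elim!: successively_mono)
  qed
  then have Y2: "geodesic Q ?O (Q # ys @ [?O])"
    using X unfolding geodesic_def by (simp add: W_def rO ys_def)
  obtain Q2' ys' where ys: "ys = Q2' # ys'"
    unfolding ys_def by (metis list.exhaust list.simps(9) rev_is_Nil_conv list.distinct(1))
  have adj: "adjacent L Q Q2'"
    using Y2 unfolding ys by (simp add: geodesic_Cons)
  have "Q2' \<in> set ys"
    by (simp add: ys)
  then have Q2': "G \<preceq> Q2'" "Q2' \<notin> set W"
    using Cs_T(2)[of Q2'] disj by (auto simp: ys_def W_def)
  \<comment> \<open>The backward half starts with a neighbour of \<open>Q\<close> outside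
    \<open>W\<close>, hence different from \<open>Q1\<close>; only \<open>Q2\<close>
    remains.\<close>
  have "Q2' = Q2"
    using at_most_two_neighbours[OF G Q1 Q2 adj Q2'(1)] Q2'(2) \<open>Q1 \<noteq> Q2\<close> by (auto simp: W_def)
  then have "rev (Q2 # ys') = map ?r (Q1 # xs)"
    using ys by (metis rev_rev_ident ys_def)
  then have "polygon L ([Q] @ (Q1 # xs) @ [?O] @ rev (Q2 # ys'))"
    using poly by (simp add: W_def)
  moreover have "geodesic Q ?O (Q # (Q1 # xs) @ [?O])"
    using X by (simp add: W_def)
  ultimately show thesis
    using that Y2 ys \<open>Q2' = Q2\<close> by simp
qed

text \<open>The key step: both walls are topes of the contraction at the class \<open>separation Q Q1\<close>, and a
  step from the first wall towards the second one crosses the required corank-two covector.\<close>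

lemma ex_corank_two:
  assumes Q1: "adjacent L Q Q1" and ST: "adjacent L S T" "separation S T = separation Q Q1"
    and "Q \<noteq> S" and disj: "separation Q Q1 \<inter> separation Q S = {}"
  obtains G where "G \<in> L" "cov_rank L G + 2 = om_rank L" "G \<preceq> Q" "G \<preceq> Q1"
    "E - supp G - separation Q Q1 \<subseteq> separation Q S"
proof -
  have tp: "Q \<in> topes L" "Q1 \<in> topes L" "S \<in> topes L"
    using Q1 ST adjacent_topes by auto
  obtain F where F: "F \<in> L" "cov_rank L F + 1 = om_rank L" "F \<preceq> Q" "F \<preceq> Q1"
    "separation Q Q1 = E - supp F"
    using adjacent_wall[OF Q1] by metis
  obtain H where H: "H \<in> L" "H \<preceq> S" "separation S T = E - supp H"
    using adjacent_wall[OF ST(1)] by metis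
  have FH: "supp F = supp H"
    using F(5) H(3) ST(2) supp_subset_ground[OF F(1)] supp_subset_ground[OF H(1)] by blast
  have val: "F e = Q e" "H e = S e" if "e \<in> supp F" for e
  proof -
    have "F e \<noteq> 0" "H e \<noteq> 0"
      using that FH unfolding supp_def by blast+
    then show "F e = Q e" "H e = S e"
      using face_leD[OF F(3)] face_leD[OF H(2)] by auto
  qed
  obtain e where e: "e \<in> separation Q S"
    using \<open>Q \<noteq> S\<close> tope_separation[OF tp(1,3)] by auto
  then have "e \<in> supp F"
    using disj F(5) separation_subset_ground[OF tope_covector[OF tp(1)], of S] by blast
  then have "F \<noteq> H"
    using val[of e] e tope_separation[OF tp(1,3)] by auto
  \<comment> \<open>The two walls have equal support, so a facet of \<open>F\<close> can be taken
    where they disagree; being a facet of a wall, it has corank two.\<close>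
  then obtain G where G: "G \<in> L" "G \<preceq> F" "cov_rank L G + 1 = cov_rank L F"
    "supp F - supp G \<subseteq> separation F H"
    using facet_in_disagreement[OF F(1) H(1) FH] by metis
  have "separation F H \<subseteq> separation Q S"
  proof
    fix f assume "f \<in> separation F H"
    then have f: "F f \<noteq> 0" "F f = - H f"
      by (simp_all add: separation_def)
    then show "f \<in> separation Q S"
      using val[of f] unfolding separation_def supp_def by simp
  qed
  then have "E - supp G - separation Q Q1 \<subseteq> separation Q S"
    using G(4) F(5) by blast
  then show thesis
    using that[of G] G(1,3) F(2) face_le_trans[OF G(2) F(3)] face_le_trans[OF G(2) F(4)] by simp
qed

section \<open>Moves\<close>

lemma braid_move_context:
  assumes "braid_move L p q"
  shows "braid_move L (us @ p @ vs) (us @ q @ vs)"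
proof -
  obtain us' a xs ys b vs' where "p = us' @ [a] @ xs @ [b] @ vs'" "q = us' @ [a] @ ys @ [b] @ vs'"
    "length xs = length ys" "polygon L ([a] @ xs @ [b] @ rev ys)"
    using assms unfolding braid_move_def by blast
  then have "us @ p @ vs = (us @ us') @ [a] @ xs @ [b] @ (vs' @ vs) \<and>
      us @ q @ vs = (us @ us') @ [a] @ ys @ [b] @ (vs' @ vs) \<and>
      length xs = length ys \<and> polygon L ([a] @ xs @ [b] @ rev ys)"
    by simp
  then show ?thesis
    unfolding braid_move_def by blast
qed

lemma braid_moves_Cons: "(braid_move L)\<^sup>*\<^sup>* p q \<Longrightarrow> (braid_move L)\<^sup>*\<^sup>* (a # p) (a # q)"
proof (induction rule: rtranclp_induct)
  case (step q r)
  then show ?case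
    using braid_move_context[of q r "[a]" "[]"] by (simp add: rtranclp.rtrancl_into_rtrancl)
qed simp

lemma nil_move_Cons: "nil_move p q \<Longrightarrow> nil_move (a # p) (a # q)"
  unfolding nil_move_def by (metis append_Cons)

text \<open>\<open>IH\<close> is connectedness at smaller distance. It turns the part of the path
  after \<open>Q\<close> into one running along a side of the polygon of \<open>G\<close>; one braid
  move changes sides, and the induction on \<open>length us\<close> takes over.\<close>

lemma braid_connects_at_crossing:
  assumes IH: "\<And>S r r'. tope_dist S R < tope_dist Q R \<Longrightarrow> geodesic S R r \<Longrightarrow> geodesic S R r' \<Longrightarrow>
      (braid_move L)\<^sup>*\<^sup>* r r'"
    and p: "geodesic Q R p" "p = us @ S # T # vs"
    and q: "geodesic Q R (Q # Q1 # q)"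
    and crossing: "separation S T = separation Q Q1" "separation Q Q1 \<inter> separation Q S = {}"
  shows "(braid_move L)\<^sup>*\<^sup>* (Q # Q1 # q) p"
  using p(2) q crossing
proof (induction "length us" arbitrary: us S T vs Q1 q rule: less_induct)
  case less
  note p_eq = less.prems(1) and q = less.prems(2) and cr = less.prems(3,4)
  have Q1: "adjacent L Q Q1" "separation Q Q1 \<subseteq> separation Q R" "geodesic Q1 R (Q1 # q)"
    using q by (auto simp: geodesic_Cons)
  have pp: "separation Q S \<subseteq> separation Q R" "geodesic Q S (us @ [S])" "geodesic S R (S # T # vs)"
    using p(1) geodesic_append_iff[of Q R us S "T # vs"] p_eq by auto
  have ST: "adjacent L S T"
    using pp(3) by (simp add: geodesic_Cons)
  have tp: "Q \<in> topes L" "Q1 \<in> topes L" "S \<in> topes L" "T \<in> topes L" "R \<in> topes L"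
    using Q1 ST adjacent_topes path_ends p(1) unfolding geodesic_def by blast+
  have lt: "tope_dist Q1 R < tope_dist Q R"
    using tope_dist_add[OF tp(1,2,5) Q1(2)] tope_dist_adjacent[OF Q1(1)] by simp
  show ?case
  proof (cases "S = Q")
    case True
    then have us: "us = []"
      using pp(2) tp(1) by (simp add: geodesic_def)
    have "T = Q1"
      using separation_inj[OF tp(1,4,2)] cr(1) True by simp
    then have "(braid_move L)\<^sup>*\<^sup>* (Q1 # q) (T # vs)"
      using IH[OF lt Q1(3)] pp(3) True by (simp add: geodesic_Cons)
    then show ?thesis
      using braid_moves_Cons p_eq us True by simp
  next
    case False
    then obtain G where G: "G \<in> L" "cov_rank L G + 2 = om_rank L" "G \<preceq> Q" "G \<preceq> Q1"
      "E - supp G - separation Q Q1 \<subseteq> separation Q S"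
      using ex_corank_two[OF Q1(1) ST cr(1)] cr(2) by metis
    obtain Q2 where Q2: "adjacent L Q Q2" "G \<preceq> Q2" "separation Q Q2 \<inter> separation Q Q1 = {}" "Q2 \<noteq> Q1"
      using ex_other_neighbour[OF G(1-3) Q1(1) G(4)] by metis
    have Q2T: "Q2 \<in> topes L"
      using Q2(1) adjacent_topes by blast
    obtain xs ys where poly: "polygon L ([Q] @ (Q1 # xs) @ [reflect G Q] @ rev (Q2 # ys))"
      and gx: "geodesic Q (reflect G Q) (Q # (Q1 # xs) @ [reflect G Q])"
      and gy: "geodesic Q (reflect G Q) (Q # (Q2 # ys) @ [reflect G Q])"
      using ex_polygon[OF G(1-3) Q1(1) G(4) Q2(1,2)] Q2(4) by metis
    let ?O = "reflect G Q"
    have OT: "?O \<in> topes L"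
      using reflect_tope G(1) tp(1) by blast
    have "separation Q ?O \<subseteq> separation Q R"
      \<comment> \<open>Outside \<open>supp G\<close> there are only the class of \<open>Q1\<close>
        and elements crossed before \<open>S\<close>, all separating \<open>Q\<close> from
        \<open>R\<close>. So some geodesic to \<open>R\<close> passes through the antipode
        \<open>?O\<close>.\<close>
      using separation_reflect[OF tp(1,1) G(1,3,3)] G(5) Q1(2) pp(1) by blast
    obtain w where w: "geodesic ?O R (?O # w)"
      using ex_geodesic OT tp(5) by blast
    have gx': "geodesic Q R (Q # Q1 # xs @ ?O # w)" and gy': "geodesic Q R (Q # Q2 # ys @ ?O # w)"
      using geodesic_append_iff[of Q R "Q # Q1 # xs" ?O w] geodesic_append_iff[of Q R "Q # Q2 # ys" ?O w]
        gx gy w \<open>separation Q ?O \<subseteq> separation Q R\<close> by simp_all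
    have "(braid_move L)\<^sup>*\<^sup>* (Q1 # q) (Q1 # xs @ ?O # w)"
      using IH[OF lt Q1(3)] gx' by (simp add: geodesic_Cons)
    then have "(braid_move L)\<^sup>*\<^sup>* (Q # Q1 # q) (Q # Q1 # xs @ ?O # w)"
      by (rule braid_moves_Cons)
    moreover have "braid_move L (Q # Q1 # xs @ ?O # w) (Q # Q2 # ys @ ?O # w)"
    proof -
      have "length (Q1 # xs) = length (Q2 # ys)"
        using gx gy by (simp add: geodesic_def)
      moreover have "Q # Q1 # xs @ ?O # w = [] @ [Q] @ (Q1 # xs) @ [?O] @ w"
        "Q # Q2 # ys @ ?O # w = [] @ [Q] @ (Q2 # ys) @ [?O] @ w"
        by simp_all
      ultimately show ?thesis
        using poly unfolding braid_move_def by blast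
    qed
    moreover have "(braid_move L)\<^sup>*\<^sup>* (Q # Q2 # ys @ ?O # w) p"
    proof -
      have "separation Q Q2 \<subseteq> E - supp G"
        using above_iff_separation[OF tp(1) Q2T G(3)] Q2(2) by blast
      then have "separation Q Q2 \<subseteq> separation Q S"
        using G(5) Q2(3) by blast
      moreover have "path L Q S (us @ [S])"
        using pp(2) by (simp add: geodesic_def)
      ultimately obtain us' S' T' vs' where *: "us @ [S] = us' @ S' # T' # vs'"
        "separation S' T' = separation Q Q2" "separation Q Q2 \<inter> separation Q S' = {}"
        using path_crosses_class adjacent_class[OF Q2(1)] by metis
      \<comment> \<open>The new crossing ends no later than \<open>S\<close>, whereas the old one
        starts at \<open>S\<close>.\<close>
      have "length us' < length us"
        using arg_cong[OF *(1), of length] by simp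
      moreover have "p = us' @ S' # T' # vs' @ T # vs"
        using p_eq arg_cong[OF *(1), of "\<lambda>l. l @ T # vs"] by simp
      ultimately show ?thesis
        using less.hyps[of us' S' T' "vs' @ T # vs" Q2 "ys @ ?O # w"] gy' *(2,3) by blast
    qed
    ultimately show ?thesis
      by (meson converse_rtranclp_into_rtranclp rtranclp_trans)
  qed
qed

lemma geodesics_braid_connected:
  "geodesic Q R p \<Longrightarrow> geodesic Q R q \<Longrightarrow> (braid_move L)\<^sup>*\<^sup>* p q"
proof (induction "tope_dist Q R" arbitrary: Q p q rule: less_induct)
  case less
  have tp: "Q \<in> topes L" "R \<in> topes L"
    using less.prems(1) path_ends unfolding geodesic_def by blast+
  obtain p' q' where pq: "p = Q # p'" "q = Q # q'"
    using less.prems unfolding geodesic_def path_iff by (metis hd_Cons_tl)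
  show ?case
  proof (cases "p'")
    case Nil
    then have "Q = R"
      using less.prems(1) pq by (simp add: geodesic_def path_singleton)
    then have "length p = length q" "length p = 1"
      using less.prems tp by (simp_all add: geodesic_def)
    then show ?thesis
      using pq by simp
  next
    case (Cons Q1 p'')
    then have p: "geodesic Q R (Q # Q1 # p'')"
      using less.prems(1) pq by simp
    then have Q1: "adjacent L Q Q1" "separation Q Q1 \<subseteq> separation Q R"
      by (auto simp: geodesic_Cons)
    have "path L Q R q"
      using less.prems(2) by (simp add: geodesic_def)
    then obtain us S T vs where "q = us @ S # T # vs" "separation S T = separation Q Q1"
      "separation Q Q1 \<inter> separation Q S = {}"
      using path_crosses_class adjacent_class[OF Q1(1)] Q1(2) by metis
    \<comment> \<open>Here \<open>q\<close> is the path in which the crossing is located, and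
      \<open>p\<close> the one braided around polygons.\<close>
    then have "(braid_move L)\<^sup>*\<^sup>* (Q # Q1 # p'') q"
      using braid_connects_at_crossing[OF _ less.prems(2) _ p] less.hyps by blast
    then show ?thesis
      using pq Cons by simp
  qed
qed

section \<open>Straightening arbitrary paths\<close>

abbreviation move :: "('a \<Rightarrow> int) list \<Rightarrow> ('a \<Rightarrow> int) list \<Rightarrow> bool" where
  "move p q \<equiv> braid_move L p q \<or> nil_move p q"

lemma moves_Cons: "move\<^sup>*\<^sup>* p q \<Longrightarrow> move\<^sup>*\<^sup>* (a # p) (a # q)"
proof (induction rule: rtranclp_induct)
  case (step q r)
  then have "move (a # q) (a # r)"
    using braid_move_context[of q r "[a]" "[]"] nil_move_Cons[of q r a] by auto
  then show ?case
    using step.IH by (rule rtranclp.rtrancl_into_rtrancl[rotated])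
qed simp

lemma geodesics_move_connected: "geodesic Q R p \<Longrightarrow> geodesic Q R q \<Longrightarrow> move\<^sup>*\<^sup>* p q"
  using geodesics_braid_connected mono_rtranclp[of "braid_move L" move] by blast

lemma path_moves_to_geodesic:
  assumes "path L Q R p"
  obtains q where "geodesic Q R q" "move\<^sup>*\<^sup>* p q"
proof -
  have "\<exists>q. geodesic Q R q \<and> move\<^sup>*\<^sup>* p q"
    using assms
  proof (induction p arbitrary: Q)
    case (Cons a p)
    have tp: "Q \<in> topes L" "R \<in> topes L" and a: "a = Q"
      using path_ends[OF Cons.prems] path_hd[OF Cons.prems] by auto
    show ?case
    proof (cases p)
      case Nil
      then have "a # p = [Q]" "Q = R"
        using Cons.prems by (auto simp: path_singleton)
      then show ?thesis
        using geodesic_singleton[OF tp(1)] by auto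
    next
      case (Cons S p')
      then have S: "adjacent L Q S" "path L S R p"
        using Cons.prems by (auto simp: path_Cons)
      then obtain q where q: "geodesic S R q" "move\<^sup>*\<^sup>* p q"
        using Cons.IH by blast
      obtain q' where q': "q = S # q'"
        using q(1) unfolding geodesic_def path_iff by (metis hd_Cons_tl)
      have to_q: "move\<^sup>*\<^sup>* (a # p) (Q # q)"
        using moves_Cons[OF q(2), of Q] a by simp
      from tope_dist_step[OF S(1) tp(2)] show ?thesis
      proof
        assume "separation Q S \<subseteq> separation Q R \<and> tope_dist Q R = Suc (tope_dist S R)"
        then have "geodesic Q R (Q # q)"
          using q(1) S(1) by (simp add: q' geodesic_Cons)
        then show ?thesis
          using to_q by blast
      next
        assume away: "separation Q S \<inter> separation Q R = {} \<and> tope_dist S R = Suc (tope_dist Q R)"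
        have ST: "S \<in> topes L" "Q \<in> topes L"
          using S(1) adjacent_topes by auto
        obtain w where w: "geodesic Q R (Q # w)"
          using ex_geodesic[OF tp] by blast
        \<comment> \<open>Since \<open>S\<close> is farther from \<open>R\<close> than
          \<open>Q\<close>, going back to \<open>Q\<close> is a step towards \<open>R\<close>; a
          geodesic from \<open>Q\<close> thus extends to one from \<open>S\<close>, which exposes
          \<open>Q, S, Q\<close>.\<close>
        have "separation S Q \<subseteq> separation S R"
          using separation_triangle[OF ST tp(2)] separation_commute_tope[OF ST] away by blast
        then have "geodesic S R (S # Q # w)"
          using w adjacent_sym[OF S(1)] by (simp add: geodesic_Cons)
        then have "move\<^sup>*\<^sup>* (Q # q) (Q # S # Q # w)"
          using moves_Cons geodesics_move_connected[OF q(1)] by blast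
        moreover have "nil_move (Q # S # Q # w) (Q # w)"
          unfolding nil_move_def by (metis append_Cons append_Nil)
        ultimately have "move\<^sup>*\<^sup>* (Q # q) (Q # w)"
          using rtranclp.rtrancl_into_rtrancl[of move "Q # q" "Q # S # Q # w" "Q # w"] by blast
        then show ?thesis
          using w to_q rtranclp_trans[OF to_q] by blast
      qed
    qed
  qed (simp add: path_iff)
  then show thesis
    using that by blast
qed

text \<open>Straightening reaches some geodesic, not necessarily the prescribed one; connectedness
  of the geodesics bridges the gap.\<close>

lemma path_convex: "path_convex L"
  unfolding path_convex_def
proof (intro ballI allI impI)
  fix Q R p r
  assume "path L Q R p" and r: "reduced_path L Q R r"
  then obtain q where q: "geodesic Q R q" "move\<^sup>*\<^sup>* p q"
    using path_moves_to_geodesic by blast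
  then have "move\<^sup>*\<^sup>* q r"
    using geodesics_move_connected r by (simp add: reduced_path_iff_geodesic)
  with q(2) show "move\<^sup>*\<^sup>* p r"
    by (rule rtranclp_trans)
qed

end

theorem theorem5p4:
  fixes E :: "'e set" and L :: "('e \<Rightarrow> int) set"
  assumes "oriented_matroid E L" and "loopless E L"
  shows "path_convex L"
proof -
  interpret loopless_oriented_matroid E L
    using assms by (intro loopless_oriented_matroid.intro loopless_oriented_matroid_axioms.intro)
  show ?thesis
    by (rule path_convex)
qed

end
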